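(* Let $D$ be a compact subset of $\mathbb{R}^2$ with nonempty interior. Then $D$ is homeomorphic to a closed $2$-dimensional disk if and only if the following four conditions hold: 1) the set $\operatorname{Int} D$ is connected; 2) the set $\mathbb{R}^2\setminus D$ is connected; 3) every $x\in\partial D$ is accessible from $\operatorname{Int} D$; 4) every $x\in\partial D$ is accessible from $\mathbb{R}^2\setminus D$.
   Context: $I=[0,1]$. $\operatorname{Int}$, $\operatorname{Cl}$ and $\partial$ denote interior, closure and boundary in $\mathbb{R}^2$. Let $X$ be a topological space and $U\subset X$ an open subset. A point $x\in\partial U$ is called accessible from $U$ if there exists a continuous injective mapping $\varphi:I\to\operatorname{Cl}U$ such that $\varphi(1)=x$ and $\varphi([0,1))\subset U$ (in the theorem, $X=\mathbb{R}^2$). *)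

theory Defs
  imports "HOL-Analysis.Analysis"
begin

definition accessible_from :: "'a::topological_space \<Rightarrow> 'a set \<Rightarrow> bool"
  where "accessible_from x U \<longleftrightarrow>
    open U \<and> x \<in> frontier U \<and>
    (\<exists>\<phi>. arc \<phi> \<and> path_image \<phi> \<subseteq> closure U \<and> \<phi> 1 = x \<and> \<phi> ` {0..<1} \<subseteq> U)"

end

theory Submission
  imports Defs "HOL-Complex_Analysis.Complex_Analysis" "HOL-Real_Asymp.Real_Asymp"
begin

text \<open>
  Identify the plane with \<open>\<complex>\<close>. If \<open>D\<close> satisfies the four conditions, \<open>Int D\<close> is simply connected, so there
  is a Riemann map \<open>f\<close> from the unit disc onto it. In logarithmic coordinates at a point \<open>\<zeta>\<close> of the circle, a
  length-area estimate gives crosscuts of \<open>Int D\<close> of arbitrarily small diameter shrinking to \<open>\<zeta>\<close>.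
  As the end points of a crosscut can be joined outside \<open>D\<close>, the crosscut lies on a Jordan curve
  meeting \<open>D\<close> only along it, so its two sides have no common limit point off the crosscut; together
  with accessibility from inside this forces \<open>f\<close> to have a limit at \<open>\<zeta>\<close>. If the extension took the same value
  at two points of the circle, the image of the chord would be a Jordan curve whose inside avoids the complement of
  \<open>D\<close>, hence the extension would be constant on an arc, which is impossible.

  Conversely, if \<open>D\<close> is a disc, only accessibility from outside is not immediate; by Janiszewski's
  theorem the complement of \<open>D\<close> is locally connected at each boundary point.
\<close>

text \<open>A priori \<open>frontier D\<close> need not be a curve or even locally connected, so
  Caratheodory's extension theorem cannot be invoked; accessibility has to act point by point. From
  outside it is applied at the end points of crosscuts, from inside at a putative second limit point
  (and to place \<open>D\<close> in the closure of its interior). The coordinate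
  \<open>Ln ((\<zeta> - z) / (\<zeta> + z))\<close> carries the disc onto a strip of width pi and
  sends \<open>\<zeta>\<close> to real part minus infinity. Arcs orthogonal to the circle and
  shrinking to \<open>\<zeta>\<close> become vertical segments, all of length pi. By Cauchy-Schwarz
  the squared length of the image of a segment is at most pi times the integral of |h'|^2 along it.
  Over all segments these integrals add up to a finite area, while the half-line of abscissae has
  infinite measure, so short images occur arbitrarily far to the left. For the limit, let crosscuts
  shrink to \<open>a\<close> and let \<open>c\<close> be another limit value. The tail of an inner
  arc ending at \<open>c\<close> misses the late crosscuts and stays to their right, whereas the
  sequence producing \<open>c\<close> ends up to their left. So \<open>c\<close> lies in the
  closures of both sides, hence on a crosscut near \<open>a\<close>.\<close>

unbundle no fps_syntax

subsection \<open>The length-area estimate\<close>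

abbreviation strip :: "complex set" where "strip \<equiv> {w. \<bar>Im w\<bar> < pi/2}"

lemma open_strip: "open strip"
proof -
  have "strip = {w. - (pi/2) < Im w} \<inter> {w. Im w < pi/2}" by auto
  moreover have "open {w. - (pi/2) < Im w}" "open {w. Im w < pi/2}"
    by (rule open_halfspace_Im_gt open_halfspace_Im_lt)+
  ultimately show ?thesis by (simp only: open_Int)
qed

lemma measurable_vector2: "(\<lambda>(x,y). vector [x,y] :: real^2) \<in> borel_measurable (lborel \<Otimes>\<^sub>M lborel)"
proof -
  have "(\<lambda>(x,y). vector [x,y] :: real^2) = (\<lambda>p. fst p *\<^sub>R axis 1 1 + snd p *\<^sub>R axis 2 1)"
    by (auto simp: fun_eq_iff vec_eq_iff forall_2 axis_def)
  moreover have "(\<lambda>p. fst p *\<^sub>R axis 1 1 + snd p *\<^sub>R axis 2 1 :: real^2) \<in> borel_measurable borel"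
    by (intro borel_measurable_continuous_onI continuous_intros)
  ultimately show ?thesis by (simp add: lborel_prod)
qed

text \<open>Cauchy-Riemann in matrix form: the Jacobian determinant of a holomorphic map with
  derivative \<open>c\<close> is |c|^2. This makes the integral of |h'|^2 an area.\<close>

lemma det_matrix_complex_mult:
  "det (matrix (\<lambda>v::real^2. vector [Re (c * Complex (v$1) (v$2)), Im (c * Complex (v$1) (v$2))] :: real^2)) = (cmod c)\<^sup>2"
  unfolding det_2 matrix_def by (simp add: axis_def cmod_def power2_eq_square)

text \<open>Bridge between two models of the plane: the change of variables formula is applied on
  \<open>real^2\<close>, iterated integrals on the product of two lines. Both measures agree on
  boxes, which determines them.\<close>

lemma lborel_vec2: "(lborel :: (real^2) measure) = distr (lborel \<Otimes>\<^sub>M lborel) borel (\<lambda>(x,y). vector [x,y])"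
proof (rule lborel_eqI)
  fix l u :: "real^2" assume le: "\<And>b. b \<in> Basis \<Longrightarrow> l \<bullet> b \<le> u \<bullet> b"
  have le': "l$i \<le> u$i" for i using le[of "axis i 1"] by (simp add: cart_eq_inner_axis)
  have "emeasure (distr (lborel \<Otimes>\<^sub>M lborel) borel (\<lambda>(x,y). vector [x,y] :: real^2)) (box l u)
     = emeasure (lborel \<Otimes>\<^sub>M lborel) ((\<lambda>(x,y). vector [x,y] :: real^2) -` box l u \<inter> space (lborel \<Otimes>\<^sub>M lborel))"
    by (rule emeasure_distr[OF measurable_vector2]) simp
  also have "(\<lambda>(x,y). vector [x,y] :: real^2) -` box l u \<inter> space (lborel \<Otimes>\<^sub>M lborel) = {l$1<..<u$1} \<times> {l$2<..<u$2}"
    by (auto simp: space_pair_measure mem_box_cart forall_2)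
  also have "emeasure (lborel \<Otimes>\<^sub>M lborel) ({l$1<..<u$1} \<times> {l$2<..<u$2}) = ennreal ((u$1 - l$1) * (u$2 - l$2))"
    using le' by (subst lborel.emeasure_pair_measure_Times) (auto simp: ennreal_mult)
  also have "(u$1 - l$1) * (u$2 - l$2) = (\<Prod>b\<in>Basis. (u - l) \<bullet> b)"
  proof -
    have "(\<Prod>b\<in>Basis. (u - l) \<bullet> b) = (\<Prod>i\<in>UNIV. (u-l)$i)"
      unfolding Basis_vec_def by (simp add: prod.UNION_disjoint UNION_singleton_eq_range prod.reindex axis_eq_axis inj_on_def inner_axis)
    then show ?thesis by (simp add: prod_2 UNIV_2)
  qed
  finally show "emeasure (distr (lborel \<Otimes>\<^sub>M lborel) borel (\<lambda>(x,y). vector [x,y] :: real^2)) (box l u) = ennreal (\<Prod>b\<in>Basis. (u - l) \<bullet> b)" .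
qed simp

lemma area_bounded:
  assumes h: "h holomorphic_on S" "inj_on h S" "bounded (h ` S)" "open S"
  shows "(\<integral>\<^sup>+x. \<integral>\<^sup>+y. indicator S (Complex x y) * ennreal ((cmod (deriv h (Complex x y)))\<^sup>2) \<partial>lborel \<partial>lborel) < \<infinity>"
proof -
  define \<phi> :: "real^2 \<Rightarrow> complex" where "\<phi> v = Complex (v$1) (v$2)" for v
  define \<psi> :: "complex \<Rightarrow> real^2" where "\<psi> z = vector [Re z, Im z]" for z
  have [simp]: "\<phi> (\<psi> z) = z" "\<psi> (\<phi> v) = v" for z v
    unfolding \<phi>_def \<psi>_def by (auto simp: vec_eq_iff forall_2)
  have lphi: "bounded_linear \<phi>"
    unfolding \<phi>_def by (intro linear_conv_bounded_linear[THEN iffD1] linearI) (auto simp: complex_eq_iff)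
  have lpsi: "bounded_linear \<psi>"
    unfolding \<psi>_def by (intro linear_conv_bounded_linear[THEN iffD1] linearI) (auto simp: vec_eq_iff forall_2)
  define S' where "S' = \<phi> -` S"
  define g where "g = \<psi> \<circ> h \<circ> \<phi>"
  have cphi: "continuous_on A \<phi>" for A by (rule bounded_linear.continuous_on[OF lphi continuous_on_id])
  have oS': "open S'" unfolding S'_def by (rule open_vimage[OF h(4) cphi])
  have der: "(g has_derivative (\<lambda>v. \<psi> (deriv h (\<phi> x) * \<phi> v))) (at x within S')" if "x \<in> S'" for x
  proof -
    have "(h has_derivative (\<lambda>v. deriv h (\<phi> x) * v)) (at (\<phi> x))"
      using h(1,4) that unfolding S'_def by (metis holomorphic_derivI has_field_derivative_def vimage_eq)
    then have "(h has_derivative (\<lambda>v. deriv h (\<phi> x) * v)) (at (\<phi> x) within \<phi> ` S')"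
      by (rule has_derivative_at_withinI)
    moreover have "(\<phi> has_derivative \<phi>) (at x within S')" by (simp add: lphi bounded_linear_imp_has_derivative)
    ultimately have "(h \<circ> \<phi> has_derivative (\<lambda>v. deriv h (\<phi> x) * v) \<circ> \<phi>) (at x within S')"
      by (rule diff_chain_within[rotated])
    from diff_chain_within[OF this bounded_linear_imp_has_derivative[OF lpsi]]
    show ?thesis by (simp add: g_def o_def)
  qed
  have inj: "inj_on g S'"
    unfolding g_def S'_def using h(2) by (auto simp: inj_on_def) (metis \<open>\<And>v. \<psi> (\<phi> v) = v\<close> \<open>\<And>z. \<phi> (\<psi> z) = z\<close>)+
  have "\<phi> ` S' = S" unfolding S'_def by (auto simp: image_iff) (metis \<open>\<And>z. \<phi> (\<psi> z) = z\<close>)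
  then have im: "g ` S' = \<psi> ` h ` S" unfolding g_def by (metis image_comp)
  have "open (h ` S)" using h by (intro open_mapping_thm3) auto
  moreover have "\<psi> ` h ` S = \<phi> -` (h ` S)" by (auto simp: image_iff) (metis \<open>\<And>v. \<psi> (\<phi> v) = v\<close>)
  ultimately have "open (g ` S')" using cphi im by (simp add: open_vimage)
  moreover have "bounded (g ` S')" unfolding im using h(3) lpsi by (rule bounded_linear_image)
  ultimately have lm: "g ` S' \<in> lmeasurable" by (simp add: lmeasurable_open)
  have det: "\<bar>det (matrix (\<lambda>v. \<psi> (deriv h (\<phi> x) * \<phi> v)))\<bar> = (cmod (deriv h (\<phi> x)))\<^sup>2" for x
    using det_matrix_complex_mult[of "deriv h (\<phi> x)"] unfolding \<psi>_def \<phi>_def by simp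
  have "S' \<in> sets lebesgue" by (metis oS' borel_open sets_completionI_sets sets_lborel)
  \<comment> \<open>For an injective differentiable map, finite measure of the image is equivalent
    to integrability of the absolute Jacobian. The argument starts from the image, whose measure is
    known to be finite.\<close>
  from measurable_differentiable_image_eq[OF this der inj] lm
  have "(\<lambda>x. (cmod (deriv h (\<phi> x)))\<^sup>2) integrable_on S'" unfolding det by simp
  then have "(\<lambda>x. (cmod (deriv h (\<phi> x)))\<^sup>2) absolutely_integrable_on S'"
    by (rule nonnegative_absolutely_integrable_1) auto
  then have fin: "(\<integral>\<^sup>+x. ennreal (norm (indicator S' x *\<^sub>R (cmod (deriv h (\<phi> x)))\<^sup>2)) \<partial>lebesgue) < \<infinity>"
    unfolding set_integrable_def integrable_iff_bounded by simp
  define k where "k v = indicator S' v * ennreal ((cmod (deriv h (\<phi> v)))\<^sup>2)" for v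
  have "continuous_on S' (\<lambda>v. deriv h (\<phi> v))"
  proof -
    have "continuous_on (\<phi> ` S') (deriv h)" unfolding \<open>\<phi> ` S' = S\<close>
      using h by (intro holomorphic_on_imp_continuous_on holomorphic_deriv)
    from continuous_on_compose[OF cphi this] show ?thesis by (simp add: o_def)
  qed
  then have "(\<lambda>v. indicator S' v *\<^sub>R (cmod (deriv h (\<phi> v)))\<^sup>2) \<in> borel_measurable borel"
    using oS' by (intro borel_measurable_continuous_on_indicator continuous_intros) auto
  then have "(\<lambda>v. ennreal (indicator S' v *\<^sub>R (cmod (deriv h (\<phi> v)))\<^sup>2)) \<in> borel_measurable borel" by measurable
  moreover have keq: "(\<lambda>v. ennreal (indicator S' v *\<^sub>R (cmod (deriv h (\<phi> v)))\<^sup>2)) = k"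
    by (auto simp: k_def fun_eq_iff indicator_def)
  ultimately have km[measurable]: "k \<in> borel_measurable borel" by (simp only: keq)
  have "k = (\<lambda>x. ennreal (norm (indicator S' x *\<^sub>R (cmod (deriv h (\<phi> x)))\<^sup>2)))" unfolding keq[symmetric]
    by (auto simp: fun_eq_iff indicator_def)
  then have "(\<integral>\<^sup>+x. k x \<partial>lebesgue) < \<infinity>" using fin by simp
  \<comment> \<open>The integrand is Borel, so passing from the completed measure to
    \<open>lborel\<close> keeps the integral; only then is it split into iterated integrals.\<close>
  then have "(\<integral>\<^sup>+x. k x \<partial>lborel) < \<infinity>"
    using km by (simp add: nn_integral_completion)
  also have "(\<integral>\<^sup>+x. k x \<partial>lborel) = (\<integral>\<^sup>+p. k (case p of (x,y) \<Rightarrow> vector [x,y]) \<partial>(lborel \<Otimes>\<^sub>M lborel))"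
    by (subst lborel_vec2, subst nn_integral_distr) (use measurable_vector2 in simp_all)
  also have "\<dots> = (\<integral>\<^sup>+x. \<integral>\<^sup>+y. k (vector [x,y]) \<partial>lborel \<partial>lborel)"
    by (subst lborel.nn_integral_fst[symmetric]) (use measurable_compose[OF measurable_vector2 km] in simp_all)
  finally show ?thesis
    by (simp add: k_def S'_def \<phi>_def indicator_def)
qed

lemma length_area:
  assumes h: "h holomorphic_on strip" "inj_on h strip" "bounded (h ` strip)" and e: "\<epsilon> > 0"
  shows "\<exists>x<X. (\<integral>\<^sup>+y. indicator strip (Complex x y) * ennreal (cmod (deriv h (Complex x y))) \<partial>lborel) < ennreal \<epsilon>"
proof (rule ccontr)
  define k where "k x y = indicator strip (Complex x y) * ennreal (cmod (deriv h (Complex x y)))" for x y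
  have kk: "k x y ^ 2 = indicator strip (Complex x y) * ennreal ((cmod (deriv h (Complex x y)))\<^sup>2)" for x y
    by (simp add: k_def indicator_def ennreal_power)
  \<comment> \<open>The indicator becomes the second factor in Cauchy-Schwarz; the integral of its
    square is the segment length pi.\<close>
  have kk': "k x y = k x y * indicator {-pi/2..pi/2} y" for x y
    by (auto simp add: k_def indicator_def)
  have km: "(\<lambda>p. k (fst p) (snd p)) \<in> borel_measurable borel"
  proof -
    define A :: "(real \<times> real) set" where "A = {p. Complex (fst p) (snd p) \<in> strip}"
    have c: "continuous_on B (\<lambda>p. Complex (fst p) (snd p))" for B :: "(real\<times>real) set"
      unfolding Complex_eq by (intro continuous_intros)
    have "open A" unfolding A_def using open_vimage[OF open_strip c] by (simp add: vimage_def)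
    moreover have "continuous_on A (\<lambda>p. deriv h (Complex (fst p) (snd p)))"
    proof -
      have "continuous_on strip (deriv h)"
        using h open_strip by (intro holomorphic_on_imp_continuous_on holomorphic_deriv)
      then show ?thesis by (rule continuous_on_compose2[OF _ c]) (auto simp: A_def)
    qed
    ultimately have "(\<lambda>p. indicator A p *\<^sub>R cmod (deriv h (Complex (fst p) (snd p)))) \<in> borel_measurable borel"
      by (intro borel_measurable_continuous_on_indicator continuous_intros) auto
    then have "(\<lambda>p. ennreal (indicator A p *\<^sub>R cmod (deriv h (Complex (fst p) (snd p))))) \<in> borel_measurable borel"
      by measurable
    also have "(\<lambda>p. ennreal (indicator A p *\<^sub>R cmod (deriv h (Complex (fst p) (snd p))))) = (\<lambda>p. k (fst p) (snd p))"
      by (auto simp: fun_eq_iff k_def A_def indicator_def)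
    finally show ?thesis .
  qed
  have km2[measurable]: "k x \<in> borel_measurable borel" for x
  proof -
    have "(\<lambda>y. (x,y)) \<in> borel_measurable borel"
      by (intro borel_measurable_continuous_onI continuous_intros)
    from measurable_compose[OF this km] show ?thesis by simp
  qed
  assume "\<not> ?thesis"
  then have ge: "ennreal \<epsilon> \<le> (\<integral>\<^sup>+y. k x y \<partial>lborel)" if "x < X" for x
    using that unfolding k_def by (meson not_less)
  have "ennreal (\<epsilon>\<^sup>2) \<le> (\<integral>\<^sup>+y. k x y ^ 2 \<partial>lborel) * ennreal pi" if "x < X" for x
  proof -
    have "ennreal (\<epsilon>\<^sup>2) = (ennreal \<epsilon>)\<^sup>2" using e by (simp add: ennreal_power)
    also have "\<dots> \<le> (\<integral>\<^sup>+y. k x y \<partial>lborel)\<^sup>2" using ge[OF that] by (simp add: power_mono)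
    also have "(\<integral>\<^sup>+y. k x y \<partial>lborel) = (\<integral>\<^sup>+y. k x y * indicator {-pi/2..pi/2} y \<partial>lborel)"
      using kk' by presburger
    also have "\<dots>\<^sup>2 \<le> (\<integral>\<^sup>+y. k x y ^ 2 \<partial>lborel) * (\<integral>\<^sup>+y. (indicator {-pi/2..pi/2} y)^2 \<partial>(lborel::real measure))"
      by (rule Cauchy_Schwarz_nn_integral) simp_all
    also have "(\<integral>\<^sup>+y. (indicator {-pi/2..pi/2} y)^2 \<partial>(lborel::real measure)) = (\<integral>\<^sup>+y. indicator {-pi/2..pi/2} y \<partial>(lborel::real measure))"
      by (intro nn_integral_cong) (auto simp: indicator_def)
    also have "\<dots> = ennreal pi" by simp
    finally show ?thesis .
  qed
  then have "(\<integral>\<^sup>+x. ennreal (\<epsilon>\<^sup>2) * indicator {..<X} x \<partial>lborel) \<le> (\<integral>\<^sup>+x. (\<integral>\<^sup>+y. k x y ^ 2 \<partial>lborel) * ennreal pi \<partial>lborel)"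
    by (intro nn_integral_mono) (auto simp: indicator_def)
  also have "\<dots> = (\<integral>\<^sup>+x. (\<integral>\<^sup>+y. k x y ^ 2 \<partial>lborel) \<partial>lborel) * ennreal pi"
  proof (rule nn_integral_multc)
    have "(\<lambda>p. k (fst p) (snd p) ^ 2) \<in> borel_measurable (lborel \<Otimes>\<^sub>M lborel)"
      using km by (simp add: lborel_prod)
    then have "(\<lambda>(x,y). k x y ^ 2) \<in> borel_measurable (lborel \<Otimes>\<^sub>M lborel)" by (simp add: case_prod_beta)
    then show "(\<lambda>x. \<integral>\<^sup>+y. k x y ^ 2 \<partial>lborel) \<in> borel_measurable lborel"
      by (rule lborel.borel_measurable_nn_integral)
  qed
  also have "\<dots> < \<infinity>"
    using area_bounded[OF h open_strip] unfolding kk by (simp add: ennreal_mult_less_top)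
  finally have "(\<integral>\<^sup>+x. ennreal (\<epsilon>\<^sup>2) * indicator {..<X} x \<partial>lborel) < \<infinity>" .
  then have "ennreal (\<epsilon>\<^sup>2) * emeasure lborel {..<X} < \<infinity>" by (simp add: nn_integral_cmult_indicator)
  moreover have "emeasure lborel {..<X} = \<infinity>"
  proof -
    \<comment> \<open>The half-line contains an interval of each length \<open>n\<close>, so it has
      infinite measure, against the finite area.\<close>
    have "real n \<le> emeasure lborel {..<X}" for n
    proof -
      have "ennreal (real n) = emeasure lborel {X - real n - 1<..<X - 1}" by (simp)
      also have "\<dots> \<le> emeasure lborel {..<X}" by (intro emeasure_mono) auto
      finally show ?thesis .
    qed
    then show ?thesis by (metis ennreal_of_nat_eq_real_of_nat ennreal_SUP_of_nat_eq_top SUP_least infinity_ennreal_def top.extremum_unique)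
  qed
  ultimately show False using e by (simp add: ennreal_mult_less_top)
qed

text \<open>An image of finite length converges at both ends, so \<open>h\<close> along the open
  segment extends to a path on the closed one. Length below \<open>\<epsilon>\<close> keeps it
  within \<open>\<epsilon>\<close> of its midpoint, the value at height 0.\<close>

lemma vertical_crosscut:
  assumes h: "h holomorphic_on strip" "inj_on h strip" "bounded (h ` strip)" and e: "\<epsilon> > 0"
  obtains x p where "x < X" "path p" "path_image p \<subseteq> cball (p (1/2)) \<epsilon>"
    "\<And>t. 0 < t \<Longrightarrow> t < 1 \<Longrightarrow> p t = h (Complex x ((t - 1/2) * pi))"
proof -
  obtain x where x: "x < X" and xint:
    "(\<integral>\<^sup>+y. indicator strip (Complex x y) * ennreal (cmod (deriv h (Complex x y))) \<partial>lborel) < ennreal \<epsilon>"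
    using length_area[OF h e] by blast
  define I where "I = {-pi/2<..<pi/2}"
  define d where "d y = deriv h (Complex x y)" for y
  \<comment> \<open>The speed of the image curve, extended by 0 so that it can be integrated over
    closed intervals and over the whole line.\<close>
  define u where "u y = indicator I y *\<^sub>R cmod (d y)" for y
  have cont_d: "continuous_on I d"
  proof -
    have "continuous_on strip (deriv h)"
      using h open_strip by (intro holomorphic_on_imp_continuous_on holomorphic_deriv)
    then show ?thesis unfolding d_def
      by (rule continuous_on_compose2) (auto simp: I_def Complex_eq intro!: continuous_intros)
  qed
  then have um: "u \<in> borel_measurable borel"
    unfolding u_def by (intro borel_measurable_continuous_on_indicator continuous_intros) (auto simp: I_def)
  have "(\<integral>\<^sup>+y. ennreal (norm (u y)) \<partial>lborel) < ennreal \<epsilon>"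
  proof -
    have "(\<lambda>y. ennreal (norm (u y))) = (\<lambda>y. indicator strip (Complex x y) * ennreal (cmod (deriv h (Complex x y))))"
      by (auto simp: fun_eq_iff u_def d_def I_def indicator_def abs_less_iff)
    then show ?thesis using xint by simp
  qed
  note nsmall = this
  then have uint: "integrable lborel u" using um
    by (simp add: integrable_iff_bounded less_top order.strict_trans)
  have un: "0 \<le> u y" for y by (simp add: u_def)
  then have "ennreal (integral\<^sup>L lborel u) = (\<integral>\<^sup>+y. ennreal (norm (u y)) \<partial>lborel)"
    using nn_integral_eq_integral[OF uint] by simp
  then have usmall: "integral\<^sup>L lborel u < \<epsilon>"
    using nsmall un ennreal_less_iff[of "integral\<^sup>L lborel u" \<epsilon>] by (simp del: real_norm_def)
  have ui: "u integrable_on UNIV" using uint by (rule integrable_on_lborel)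
  have uic: "u integrable_on {a..b}" for a b using integrable_on_subcbox[OF ui, of a b] by simp
  \<comment> \<open>Arc length from the lower end. It is continuous up to both ends and dominates
    the increments of \<open>\<gamma>\<close>, which itself is controlled only on the open
    segment.\<close>
  define \<Phi> where "\<Phi> y = integral {-pi/2..y} u" for y
  define \<gamma> where "\<gamma> y = h (Complex x y)" for y
  have step: "cmod (\<gamma> b - \<gamma> a) \<le> \<Phi> b - \<Phi> a" if "a \<in> I" "b \<in> I" "a \<le> b" for a b
  proof -
    have sub: "{a..b} \<subseteq> I" using that by (auto simp: I_def)
    have "(\<gamma> has_vector_derivative (\<i> * d y)) (at y within {a..b})" if "y \<in> {a..b}" for y
    proof -
      have "y \<in> I" using that sub by blast
      then have "Complex x y \<in> strip" by (auto simp: I_def)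
      then have "(h has_field_derivative d y) (at (Complex x y))"
        unfolding d_def using h open_strip by (metis holomorphic_derivI)
      moreover have "(Complex x has_vector_derivative \<i>) (at y)"
        unfolding Complex_eq has_vector_derivative_def by (auto intro!: derivative_eq_intros simp: fun_eq_iff scaleR_conv_of_real mult.commute)
      ultimately have "(h \<circ> Complex x has_vector_derivative \<i> * d y) (at y)"
        using field_vector_diff_chain_at by blast
      then show ?thesis unfolding \<gamma>_def o_def by (rule has_vector_derivative_at_within)
    qed
    then have fi: "((\<lambda>y. \<i> * d y) has_integral (\<gamma> b - \<gamma> a)) {a..b}"
      using that by (intro fundamental_theorem_of_calculus)
    have "cmod (\<gamma> b - \<gamma> a) = cmod (integral {a..b} (\<lambda>y. \<i> * d y))"
      by (subst integral_unique[OF fi]) (rule refl)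
    also have "\<dots> \<le> integral {a..b} u"
      by (rule integral_norm_bound_integral) (use fi uic sub in \<open>auto simp: has_integral_integrable u_def norm_mult\<close>)
    also have "\<dots> = \<Phi> b - \<Phi> a"
      using Henstock_Kurzweil_Integration.integral_combine[where a="-pi/2" and c=a and b=b, OF _ _ uic] that unfolding \<Phi>_def I_def by simp
    finally show ?thesis .
  qed
  have cPhi: "continuous_on {-pi/2..pi/2} \<Phi>"
    unfolding \<Phi>_def by (rule indefinite_integral_continuous_1[OF uic])
  then have ucPhi: "uniformly_continuous_on {-pi/2..pi/2} \<Phi>" by (simp add: compact_uniformly_continuous)
  have step': "cmod (\<gamma> b - \<gamma> a) \<le> \<bar>\<Phi> b - \<Phi> a\<bar>" if "a \<in> I" "b \<in> I" for a b
    using step[of a b] step[of b a] that by (cases "a \<le> b") (auto simp: norm_minus_commute)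
  \<comment> \<open>Inherited from \<open>\<Phi>\<close>, which is uniformly continuous on the
    compact interval; this is what provides the extension to the end points.\<close>
  have "uniformly_continuous_on I \<gamma>"
    unfolding uniformly_continuous_on_def dist_norm
  proof (intro allI impI)
    fix e :: real assume "e > 0"
    then obtain \<delta> where "\<delta> > 0" and \<delta>: "\<And>y z. y \<in> {-pi/2..pi/2} \<Longrightarrow> z \<in> {-pi/2..pi/2} \<Longrightarrow> norm (z - y) < \<delta> \<Longrightarrow> norm (\<Phi> z - \<Phi> y) < e"
      using ucPhi unfolding uniformly_continuous_on_def dist_norm by metis
    have "cmod (\<gamma> z - \<gamma> y) < e" if "y \<in> I" "z \<in> I" "norm (z - y) < \<delta>" for y z
      using \<delta>[of y z] step'[of y z] that by (simp add: I_def)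
    then show "\<exists>d>0. \<forall>y\<in>I. \<forall>z\<in>I. norm (z - y) < d \<longrightarrow> cmod (\<gamma> z - \<gamma> y) < e"
      using \<open>\<delta> > 0\<close> by blast
  qed
  then obtain c where uc: "uniformly_continuous_on (closure I) c" and cg: "\<And>y. y \<in> I \<Longrightarrow> \<gamma> y = c y"
    by (rule uniformly_continuous_on_extension_on_closure) blast
  have clI: "closure I = {-pi/2..pi/2}" unfolding I_def by (rule closure_greaterThanLessThan) simp
  have cc: "continuous_on {-pi/2..pi/2} c" using uc clI uniformly_continuous_imp_continuous by fastforce
  have "\<Phi> a \<le> integral\<^sup>L lborel u" for a
  proof -
    have "\<Phi> a \<le> integral UNIV u" unfolding \<Phi>_def by (rule integral_subset_le) (auto intro: uic ui simp: u_def)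
    also have "\<dots> = integral\<^sup>L lborel u" using uint by (rule integral_lborel)
    finally show ?thesis .
  qed
  moreover have "0 \<le> \<Phi> a" for a unfolding \<Phi>_def by (rule integral_nonneg) (auto simp: u_def intro: uic)
  ultimately have PP: "0 \<le> \<Phi> a" "\<Phi> a < \<epsilon>" for a
    using usmall by (auto intro: le_less_trans)
  have "\<gamma> y \<in> cball (\<gamma> 0) \<epsilon>" if "y \<in> I" for y
  proof -
    have "0 \<in> I" by (simp add: I_def)
    then have "cmod (\<gamma> 0 - \<gamma> y) \<le> \<bar>\<Phi> 0 - \<Phi> y\<bar>" using step' that by blast
    then show ?thesis using PP[of 0] PP[of y] by (simp add: dist_norm)
  qed
  then have I0: "\<gamma> ` I \<subseteq> cball (\<gamma> 0) \<epsilon>" by blast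
  have "c ` closure I \<subseteq> cball (\<gamma> 0) \<epsilon>"
  proof (rule image_closure_subset)
    show "c ` I \<subseteq> cball (\<gamma> 0) \<epsilon>" using I0 cg by (metis image_cong)
  qed (use cc clI in auto)
  define p where "p t = c ((t - 1/2) * pi)" for t
  have rng: "(t - 1/2) * pi \<in> {-pi/2..pi/2}" if "t \<in> {0..1}" for t
  proof -
    have "(-1/2) * pi \<le> (t-1/2)*pi" "(t-1/2) * pi \<le> (1/2)*pi" using that by (intro mult_right_mono; auto)+
    then show ?thesis by auto
  qed
  show thesis
  proof
    show "x < X" by fact
    show "path p" unfolding path_def p_def
      by (rule continuous_on_compose2[OF cc]) (use rng in \<open>auto intro!: continuous_intros\<close>)
    show "path_image p \<subseteq> cball (p (1/2)) \<epsilon>"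
    proof -
      have "0 \<in> I" by (simp add: I_def)
      then have "p (1/2) = \<gamma> 0" unfolding p_def using cg by simp
      moreover have "path_image p \<subseteq> c ` closure I" unfolding clI path_image_def p_def using rng by blast
      ultimately show ?thesis using \<open>c ` closure I \<subseteq> _\<close> by auto
    qed
    fix t :: real assume "0 < t" "t < 1"
    then have "(-1/2) * pi < (t-1/2)*pi" "(t-1/2) * pi < (1/2)*pi" by (intro mult_strict_right_mono; auto)+
    then show "p t = h (Complex x ((t - 1/2) * pi))"
      unfolding p_def using cg[of "(t-1/2)*pi"] by (simp add: I_def \<gamma>_def)
  qed
qed

subsection \<open>Crosscuts and Jordan curves\<close>

text \<open>A connected set off the curve lies on one side. Every curve point is on the frontier of
  both sides, so the open set \<open>G\<close> meets both; as \<open>L\<close> and \<open>R\<close>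
  cover \<open>G\<close> off the curve, they cannot share a side.\<close>

lemma jordan_sides:
  fixes j :: "real \<Rightarrow> complex"
  assumes j: "simple_path j" "pathfinish j = pathstart j" and G: "open G" "G \<inter> path_image j \<noteq> {}"
    and L: "connected L" "L \<inter> path_image j = {}" and R: "connected R" "R \<inter> path_image j = {}"
    and LR: "G - path_image j \<subseteq> L \<union> R"
  shows "L \<subseteq> inside (path_image j) \<and> R \<subseteq> outside (path_image j) \<or>
         L \<subseteq> outside (path_image j) \<and> R \<subseteq> inside (path_image j)"
proof -
  let ?I = "inside (path_image j)" and ?O = "outside (path_image j)"
  have JJ: "open ?I" "open ?O" "?I \<inter> ?O = {}" "?I \<union> ?O = - path_image j"
      "frontier ?I = path_image j" "frontier ?O = path_image j"
    using Jordan_inside_outside[OF j] by auto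
  have side: "C \<subseteq> ?I \<or> C \<subseteq> ?O" if "connected C" "C \<inter> path_image j = {}" for C
  proof (rule ccontr)
    assume "\<not> ?thesis"
    then have "?I \<inter> C \<noteq> {}" "?O \<inter> C \<noteq> {}" using that JJ(4) by blast+
    then show False
      using connectedD[OF that(1) JJ(1,2)] JJ(3,4) that(2) by blast
  qed
  have meets: "G \<inter> ?I \<noteq> {}" "G \<inter> ?O \<noteq> {}"
  proof -
    obtain q where q: "q \<in> G" "q \<in> path_image j" using G by blast
    then have "q \<in> closure ?I" "q \<in> closure ?O" using JJ(5,6) by (auto simp: frontier_def)
    then show "G \<inter> ?I \<noteq> {}" "G \<inter> ?O \<noteq> {}"
      using q G(1) by (metis disjoint_iff open_Int_closure_eq_empty)+
  qed
  have "\<not> (L \<subseteq> ?I \<and> R \<subseteq> ?I)" "\<not> (L \<subseteq> ?O \<and> R \<subseteq> ?O)"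
    using meets LR JJ(3,4) by blast+
  then show ?thesis using side[OF L] side[OF R] by blast
qed

lemma jordan_closures:
  fixes j :: "real \<Rightarrow> complex"
  assumes j: "simple_path j" "pathfinish j = pathstart j"
    and LR: "L \<subseteq> inside (path_image j) \<and> R \<subseteq> outside (path_image j) \<or>
         L \<subseteq> outside (path_image j) \<and> R \<subseteq> inside (path_image j)"
  shows "closure L \<inter> closure R \<subseteq> path_image j"
proof -
  let ?I = "inside (path_image j)" and ?O = "outside (path_image j)"
  have JJ: "?I \<inter> ?O = {}" "frontier ?I = path_image j" "frontier ?O = path_image j"
    using Jordan_inside_outside[OF j] by auto
  then have "closure ?I = ?I \<union> path_image j" "closure ?O = ?O \<union> path_image j"
    by (simp_all add: closure_Un_frontier)
  then have "closure ?I \<inter> closure ?O \<subseteq> path_image j" using JJ(1) by blast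
  then show ?thesis using LR closure_mono by blast
qed

text \<open>Membership in \<open>A\<close> tells inner parameters from end parameters, so the only
  possible coincidence is \<open>p 0 = p 1\<close>, which \<open>loop_free\<close> permits.\<close>

lemma loop_free_if_endpoints_outside:
  assumes "p ` {0<..<1} \<subseteq> A" "p 0 \<notin> A" "p 1 \<notin> A" "inj_on p {0<..<1}"
  shows "loop_free p"
  unfolding loop_free_def
proof (intro ballI impI)
  fix x y :: real assume xy: "x \<in> {0..1}" "y \<in> {0..1}" "p x = p y"
  have ne: "p s \<noteq> p t" if "s \<in> {0<..<1}" "t = 0 \<or> t = 1" for s t :: real
  proof -
    have "p s \<in> A" using that(1) assms(1) by blast
    moreover have "p t \<notin> A" using that(2) assms(2,3) by auto
    ultimately show ?thesis by metis
  qed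
  have "t = 0 \<or> t = 1 \<or> t \<in> {0<..<1}" if "t \<in> {0..1}" for t :: real using that by auto
  from this[OF xy(1)] this[OF xy(2)] show "x = y \<or> x = 0 \<and> y = 1 \<or> x = 1 \<and> y = 0"
    using ne[of x y] ne[of y x] xy(3) inj_onD[OF assms(4) xy(3)] by (elim disjE) auto
qed

text \<open>The two accessing arcs lead from the end points into the connected open set
  \<open>- D\<close>, where they are joined. If the ends of the crosscut coincide, it is a Jordan
  curve already.\<close>

lemma crosscut_extends_to_Jordan:
  fixes D :: "complex set"
  assumes "closed D" "connected (- D)" and p: "path p" "p 0 \<in> frontier D" "p 1 \<in> frontier D"
    "p ` {0<..<1} \<subseteq> interior D" "inj_on p {0<..<1}"
    and acc: "accessible_from (p 0) (- D)" "accessible_from (p 1) (- D)"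
  obtains j where "simple_path j" "pathfinish j = pathstart j" "path_image p \<subseteq> path_image j"
    "path_image j \<inter> D \<subseteq> path_image p"
proof -
  have fi: "frontier D \<inter> interior D = {}" by (auto simp: frontier_def)
  have fD: "frontier D \<subseteq> D" using assms(1) by (rule frontier_subset_closed)
  have split: "t = 0 \<or> t = 1 \<or> t \<in> {0<..<1}" if "t \<in> {0..1}" for t :: real using that by auto
  have lf: "loop_free p"
    using fi p by (intro loop_free_if_endpoints_outside[where A="interior D"]) blast+
  show thesis
  proof (cases "p 0 = p 1")
    case True
    then have "simple_path p" using p(1) lf by (simp add: simple_path_def)
    with True that[of p] show ?thesis by (auto simp: pathstart_def pathfinish_def)
  next
    case False
    have "pathstart p \<noteq> pathfinish p" using False by (simp add: pathstart_def pathfinish_def)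
    then have arcp: "arc p" using p(1) lf by (simp add: arc_simple_path simple_path_def)
    obtain a where a: "arc a" "a 1 = p 0" "a ` {0..<1} \<subseteq> - D" using acc(1) unfolding accessible_from_def by auto
    obtain b where b: "arc b" "b 1 = p 1" "b ` {0..<1} \<subseteq> - D" using acc(2) unfolding accessible_from_def by auto
    have "path_connected (- D)" using assms(1,2) by (simp add: connected_open_path_connected open_Compl)
    moreover have "b 0 \<in> - D" "a 0 \<in> - D" using a(3) b(3) by (simp_all add: image_subset_iff)
    ultimately obtain q where q: "path q" "path_image q \<subseteq> - D" "pathstart q = b 0" "pathfinish q = a 0"
      unfolding path_connected_def by metis
    let ?g = "reversepath b +++ (q +++ a)"
    have st: "pathstart a = a 0" "pathstart b = b 0" "pathfinish a = p 0" "pathfinish b = p 1"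
      using a(2) b(2) by (simp_all add: pathstart_def pathfinish_def)
    then have pg: "path ?g"
      using a(1) b(1) q by (simp add: arc_imp_path)
    have ends: "pathstart ?g = p 1" "pathfinish ?g = p 0" using st by simp_all
    have u: "{0..1::real} = insert 1 {0..<1}" by auto
    have ima: "path_image a \<subseteq> insert (p 0) (- D)" using a(2,3) unfolding path_image_def u by (simp add: subset_insertI2)
    have imb: "path_image b \<subseteq> insert (p 1) (- D)" using b(2,3) unfolding path_image_def u by (simp add: subset_insertI2)
    \<comment> \<open>The detour touches \<open>D\<close> in at most the two end points. Hence an
      arc extracted from it meets \<open>p\<close> only there, as needed to close up a simple
      loop.\<close>
    have img: "path_image ?g \<subseteq> {p 0, p 1} \<union> - D"
      using ima imb q(2) by (intro order_trans[OF path_image_join_subset] Un_least) (auto simp: path_image_reversepath)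
    obtain r where r: "arc r" "path_image r \<subseteq> path_image ?g" "pathstart r = p 1" "pathfinish r = p 0"
      using path_contains_arc[OF pg ends] False by metis
    have pD: "path_image p \<subseteq> D"
      using p(2-4) fD interior_subset split unfolding path_image_def by blast
    show ?thesis
    proof (rule that[of "p +++ r"])
      show "simple_path (p +++ r)"
        using pD r img arcp by (intro simple_path_join_loop) (auto simp: pathstart_def pathfinish_def)
      have "pathfinish p = pathstart r" using r by (simp add: pathfinish_def)
      then have "path_image (p +++ r) = path_image p \<union> path_image r" by (rule path_image_join)
      moreover have "p 0 \<in> path_image p" "p 1 \<in> path_image p" by (auto simp: path_image_def)
      ultimately show "path_image p \<subseteq> path_image (p +++ r)" "path_image (p +++ r) \<inter> D \<subseteq> path_image p"
        using r(2) img by auto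
      show "pathfinish (p +++ r) = pathstart (p +++ r)" using r(4) by (simp) (simp add: pathstart_def)
    qed
  qed
qed

text \<open>The completed Jordan curve meets \<open>interior D\<close> exactly along the open
  crosscut, so \<open>L\<close> and \<open>R\<close> lie on opposite sides of it. Their common limit
  points are on the curve and in the closed set \<open>D\<close>, hence on the crosscut.\<close>

lemma crosscut_separates:
  fixes D :: "complex set"
  assumes D: "closed D" "connected (- D)" and p: "path p" "p 0 \<in> frontier D" "p 1 \<in> frontier D"
    "p ` {0<..<1} \<subseteq> interior D" "inj_on p {0<..<1}"
    and acc: "accessible_from (p 0) (- D)" "accessible_from (p 1) (- D)"
    and L: "connected L" and R: "connected R"
    and cover: "interior D - p ` {0<..<1} = L \<union> R"
  shows "closure L \<inter> closure R \<subseteq> path_image p"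
proof -
  obtain j where j: "simple_path j" "pathfinish j = pathstart j" "path_image p \<subseteq> path_image j"
    "path_image j \<inter> D \<subseteq> path_image p"
    using crosscut_extends_to_Jordan[OF D p acc] .
  have pim: "path_image p \<inter> interior D = p ` {0<..<1}"
  proof -
    have "path_image p = insert (p 0) (insert (p 1) (p ` {0<..<1}))"
      unfolding path_image_def by (force simp: image_iff)
    then show ?thesis using p(2-4) by (auto simp: frontier_def)
  qed
  then have jG: "path_image j \<inter> interior D = p ` {0<..<1}"
    using j(3,4) interior_subset[of D] by blast
  have "closure L \<inter> closure R \<subseteq> path_image j"
  proof (rule jordan_closures[OF j(1,2)], rule jordan_sides[OF j(1,2), where G="interior D"])
    have "p (1/2) \<in> p ` {0<..<1}" by auto
    then show "interior D \<inter> path_image j \<noteq> {}" using jG by blast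
    show "L \<inter> path_image j = {}" "R \<inter> path_image j = {}" "interior D - path_image j \<subseteq> L \<union> R"
      using cover jG by blast+
  qed (use L R in auto)
  moreover have "closure L \<subseteq> D"
    using D(1) cover interior_subset[of D] by (intro closure_minimal) auto
  ultimately show ?thesis using j(4) by blast
qed

subsection \<open>Boundary extension of the Riemann map\<close>

lemma Re_to_minus_infinity_diverges:
  assumes "\<And>n. Re (w n) \<le> - real n"
  shows "\<not> w \<longlonglongrightarrow> v"
proof
  assume "w \<longlonglongrightarrow> v"
  then have "(\<lambda>n. Re (w n)) \<longlonglongrightarrow> Re v" by (rule tendsto_Re)
  then have "bounded (range (\<lambda>n. Re (w n)))" by (rule convergent_imp_bounded)
  then obtain B where B: "\<And>n. \<bar>Re (w n)\<bar> \<le> B" by (auto simp: bounded_iff)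
  obtain n where "real n > B" using reals_Archimedean2 by blast
  then show False using assms[of n] B[of n] by linarith
qed

locale biaccessible =
  fixes D :: "complex set"
  assumes compact_D: "compact D" and connected_outside: "connected (- D)"
    and connected_interior: "connected (interior D)"
    and accessible_inside: "x \<in> frontier D \<Longrightarrow> accessible_from x (interior D)"
    and accessible_outside: "x \<in> frontier D \<Longrightarrow> accessible_from x (- D)"
begin

text \<open>Properness: were the limit interior, continuity of the inverse \<open>k\<close> would
  make \<open>w\<close> converge to \<open>k c\<close> in \<open>S\<close>.\<close>

lemma homeomorphism_seq_limit:
  assumes hom: "homeomorphism S (interior D) h k" and w: "\<And>n. w n \<in> S" "(\<lambda>n. h (w n)) \<longlonglongrightarrow> c"
    and nolim: "\<And>v. v \<in> S \<Longrightarrow> \<not> w \<longlonglongrightarrow> v"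
  shows "c \<in> frontier D"
proof (rule ccontr)
  assume "c \<notin> frontier D"
  moreover have inD: "h (w n) \<in> interior D" for n using hom w(1) by (metis homeomorphism_def imageI)
  then have "c \<in> closure (interior D)"
    using w(2) unfolding closure_sequential by (intro exI[of _ "\<lambda>n. h (w n)"]) simp
  then have "c \<in> closure D" using closure_mono[OF interior_subset] by blast
  ultimately have c: "c \<in> interior D" by (auto simp: frontier_def)
  have "continuous_on (interior D) k" using hom by (simp add: homeomorphism_def)
  then have "(\<lambda>n. k (h (w n))) \<longlonglongrightarrow> k c"
    using w(2) c inD by (intro continuous_on_tendsto_compose[where f=k]) auto
  moreover have "k (h (w n)) = w n" for n using hom w(1) by (metis homeomorphism_def imageI)
  ultimately have "w \<longlonglongrightarrow> k c" by simp
  moreover have "k c \<in> S" using hom c by (metis homeomorphism_def imageI)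
  ultimately show False using nolim by blast
qed

text \<open>The vertical line at \<open>x\<close> cuts the strip into two convex halves; their
  images are the connected sides to which the separation result is applied.\<close>

lemma strip_crosscut:
  assumes hol: "h holomorphic_on strip" and hom: "homeomorphism strip (interior D) h k" and e: "\<epsilon> > 0"
  obtains x p where "x < X" "path p" "path_image p \<subseteq> cball (p (1/2)) \<epsilon>"
    "p (1/2) \<in> interior D"
    "interior D - h ` {w \<in> strip. Re w < x} - h ` {w \<in> strip. Re w > x} \<subseteq> path_image p"
    "closure (h ` {w \<in> strip. Re w < x}) \<inter> closure (h ` {w \<in> strip. Re w > x}) \<subseteq> path_image p"
proof -
  have inj: "inj_on h strip" using hom by (metis homeomorphism_def inj_on_inverseI)
  have img: "h ` strip = interior D" using hom by (simp add: homeomorphism_def)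
  have "bounded (h ` strip)" unfolding img using compact_D bounded_interior compact_imp_bounded by blast
  from vertical_crosscut[OF hol inj this e] obtain x p where p: "x < X" "path p" "path_image p \<subseteq> cball (p (1/2)) \<epsilon>"
    "\<And>t. 0 < t \<Longrightarrow> t < 1 \<Longrightarrow> p t = h (Complex x ((t - 1/2) * pi))" by metis
  let ?\<gamma> = "\<lambda>t. Complex x ((t - 1/2) * pi)"
  have g_strip: "?\<gamma> t \<in> strip \<longleftrightarrow> t \<in> {0<..<1}" for t
  proof -
    have "?\<gamma> t \<in> strip \<longleftrightarrow> \<bar>t - 1/2\<bar> * pi < (1/2) * pi" by (simp add: abs_mult)
    also have "\<dots> \<longleftrightarrow> \<bar>t - 1/2\<bar> < 1/2" using pi_gt_zero mult_less_cancel_right_pos by blast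
    also have "\<dots> \<longleftrightarrow> t \<in> {0<..<1}" unfolding abs_less_iff greaterThanLessThan_iff by linarith
    finally show ?thesis .
  qed
  have pim: "p ` {0<..<1} = h ` {w \<in> strip. Re w = x}"
  proof -
    have "p ` {0<..<1} = h ` ?\<gamma> ` {0<..<1}" unfolding image_image by (rule image_cong) (auto simp: p(4))
    moreover have "?\<gamma> ` {0<..<1} = {w \<in> strip. Re w = x}"
    proof (intro equalityI subsetI)
      fix w assume w: "w \<in> {w \<in> strip. Re w = x}"
      define t where "t = Im w / pi + 1/2"
      have wt: "w = ?\<gamma> t" using w by (simp add: t_def complex_eq_iff)
      then have "t \<in> {0<..<1}" using w g_strip[of t] by (metis (no_types, lifting) mem_Collect_eq)
      then show "w \<in> ?\<gamma> ` {0<..<1}" unfolding wt by (rule imageI)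
    next
      fix w assume "w \<in> ?\<gamma> ` {0<..<1}"
      then obtain t where "w = ?\<gamma> t" "t \<in> {0<..<1}" by blast
      then show "w \<in> {w \<in> strip. Re w = x}" using g_strip[of t] by simp
    qed
    ultimately show ?thesis by simp
  qed
  have endpt: "p s \<in> frontier D" if s: "s = 0 \<or> s = 1" for s
  proof -
    \<comment> \<open>The shift by 2 keeps every \<open>t n\<close> strictly between 0 and 1,
      starting with \<open>n = 0\<close>. The points \<open>?\<gamma> (t n)\<close> tend to a point
      outside the strip, so properness places \<open>p s\<close> on the frontier.\<close>
    define t where "t n = (if s = 0 then inverse (real (n+2)) else 1 - inverse (real (n+2)))" for n
    have t01: "t n \<in> {0<..<1}" for n by (auto simp: t_def field_simps)
    have l0: "(\<lambda>n. inverse (real (n+2))) \<longlonglongrightarrow> 0"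
      using LIMSEQ_ignore_initial_segment[OF lim_inverse_n, of 2] by simp
    have tl: "t \<longlonglongrightarrow> s" using s l0 tendsto_diff[OF tendsto_const l0, of 1] unfolding t_def by auto
    have "(\<lambda>n. p (t n)) \<longlonglongrightarrow> p s"
      using p(2) t01 s by (intro continuous_on_tendsto_compose[OF _ tl, of "{0..1}"]) (auto simp: path_def less_imp_le)
    then have "(\<lambda>n. h (?\<gamma> (t n))) \<longlonglongrightarrow> p s" using p(4) t01 by (simp)
    moreover have "(\<lambda>n. ?\<gamma> (t n)) \<longlonglongrightarrow> ?\<gamma> s" by (intro tendsto_intros tl)
    moreover have "?\<gamma> s \<notin> strip" using g_strip s by auto
    moreover have "?\<gamma> (t n) \<in> strip" for n using g_strip t01 by blast
    ultimately show ?thesis using homeomorphism_seq_limit[OF hom, of "\<lambda>n. ?\<gamma> (t n)" "p s"] LIMSEQ_unique by metis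
  qed
  have convs: "convex strip"
  proof -
    have "strip = {w. - (pi/2) < Im w} \<inter> {w. Im w < pi/2}" by auto
    then show ?thesis by (metis convex_Int convex_halfspace_Im_gt convex_halfspace_Im_lt)
  qed
  have hcont: "continuous_on A h" if "A \<subseteq> strip" for A
    using hol that continuous_on_subset holomorphic_on_imp_continuous_on by blast
  have connL: "connected (h ` {w \<in> strip. Re w < x})"
  proof (intro connected_continuous_image hcont)
    have "{w \<in> strip. Re w < x} = strip \<inter> {w. Re w < x}" by auto
    then show "connected {w \<in> strip. Re w < x}"
      using convs convex_halfspace_Re_lt by (metis convex_Int convex_connected)
  qed auto
  have connR: "connected (h ` {w \<in> strip. Re w > x})"
  proof (intro connected_continuous_image hcont)
    have "{w \<in> strip. Re w > x} = strip \<inter> {w. Re w > x}" by auto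
    then show "connected {w \<in> strip. Re w > x}"
      using convs convex_halfspace_Re_gt by (metis convex_Int convex_connected)
  qed auto
  have cover: "interior D - p ` {0<..<1} = h ` {w \<in> strip. Re w < x} \<union> h ` {w \<in> strip. Re w > x}"
  proof -
    have "h ` (strip - {w \<in> strip. Re w = x}) = h ` strip - h ` {w \<in> strip. Re w = x}"
      by (rule inj_on_image_set_diff[OF inj]) auto
    moreover have "strip - {w \<in> strip. Re w = x} = {w \<in> strip. Re w < x} \<union> {w \<in> strip. Re w > x}" by auto
    ultimately show ?thesis unfolding pim img[symmetric] by (simp add: image_Un)
  qed
  have injp: "inj_on p {0<..<1}"
  proof (rule inj_onI)
    fix t u assume tu: "t \<in> {0<..<1}" "u \<in> {0<..<1}" "p t = p u"
    then have "?\<gamma> t = ?\<gamma> u" using inj g_strip p(4) by (metis greaterThanLessThan_iff inj_onD)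
    then show "t = u" by auto
  qed
  have pD: "p ` {0<..<1} \<subseteq> interior D" using pim img by blast
  have ends: "p 0 \<in> frontier D" "p 1 \<in> frontier D" using endpt by blast+
  have "closure (h ` {w \<in> strip. Re w < x}) \<inter> closure (h ` {w \<in> strip. Re w > x}) \<subseteq> path_image p"
    using crosscut_separates[OF compact_imp_closed[OF compact_D] connected_outside p(2) ends pD injp
      ends[THEN accessible_outside] connL connR cover] .
  moreover have "interior D - h ` {w \<in> strip. Re w < x} - h ` {w \<in> strip. Re w > x} \<subseteq> path_image p"
  proof -
    have "p ` {0<..<1} \<subseteq> path_image p" unfolding path_image_def by (intro image_mono) auto
    then show ?thesis using cover by blast
  qed
  moreover have "p (1/2) \<in> interior D" using pD by (simp add: image_subset_iff)
  ultimately show ?thesis using that p(1-3) by blast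
qed

lemma strip_end_limit:
  assumes hol: "h holomorphic_on strip" and hom: "homeomorphism strip (interior D) h k"
  obtains a where "a \<in> frontier D" "\<And>\<epsilon>. \<epsilon> > 0 \<Longrightarrow> \<exists>X. \<forall>w\<in>strip. Re w < X \<longrightarrow> dist (h w) a < \<epsilon>"
proof -
  have inj: "inj_on h strip" using hom by (metis homeomorphism_def inj_on_inverseI)
  have img: "h ` strip = interior D" using hom by (simp add: homeomorphism_def)
  define L where "L x = h ` {w \<in> strip. Re w < x}" for x
  define R where "R x = h ` {w \<in> strip. Re w > x}" for x
  have "\<exists>x p. x < - real n \<and> path_image p \<subseteq> cball (p (1/2)) (1 / real (Suc n)) \<and>
    p (1/2) \<in> interior D \<and>
    interior D - L x - R x \<subseteq> path_image p \<and>
    closure (L x) \<inter> closure (R x) \<subseteq> path_image p" for n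
    unfolding L_def R_def by (rule strip_crosscut[OF hol hom, of "1 / real (Suc n)" "- real n"]) auto
  then obtain x p where x: "\<And>n. x n < - real n" and pc: "\<And>n. path_image (p n) \<subseteq> cball (p n (1/2)) (1 / real (Suc n))"
    and pD: "\<And>n. p n (1/2) \<in> interior D"
    and cov: "\<And>n. interior D - L (x n) - R (x n) \<subseteq> path_image (p n)"
    and sep: "\<And>n. closure (L (x n)) \<inter> closure (R (x n)) \<subseteq> path_image (p n)"
    by metis
  have open_half: "open {w \<in> strip. Re w < X}" "open {w \<in> strip. Re w > X}" for X
    using open_Int[OF open_strip open_halfspace_Re_lt[of X]] open_Int[OF open_strip open_halfspace_Re_gt[of X]]
    by (simp_all add: Int_def)
  have openLR: "open (L X)" "open (R X)" for X
    unfolding L_def R_def using hol inj open_half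
    by (auto intro!: open_mapping_thm3 elim: holomorphic_on_subset inj_on_subset)
  have "\<And>n. p n (1/2) \<in> D" using pD interior_subset by blast
  \<comment> \<open>The candidate limit is a cluster point of the crosscut midpoints; as the
    diameters tend to 0, whole crosscuts approach it along \<open>r\<close>.\<close>
  then obtain a r where r: "strict_mono r" "((\<lambda>n. p n (1/2)) \<circ> r) \<longlonglongrightarrow> a"
    using compact_D unfolding compact_def by metis
  have lim: "\<exists>X. \<forall>w\<in>strip. Re w < X \<longrightarrow> dist (h w) a < \<epsilon>" if e: "\<epsilon> > 0" for \<epsilon>
  proof (rule ccontr)
    assume "\<not> ?thesis"
    then have "\<forall>n. \<exists>w. w \<in> strip \<and> Re w < - real n \<and> dist (h w) a \<ge> \<epsilon>" by (meson not_less)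
    then obtain w where w: "\<And>n. w n \<in> strip" "\<And>n. Re (w n) < - real n" "\<And>n. dist (h (w n)) a \<ge> \<epsilon>" by metis
    have "\<And>n. h (w n) \<in> D" using w(1) img interior_subset by blast
    then obtain c s where s: "strict_mono s" "((\<lambda>n. h (w n)) \<circ> s) \<longlonglongrightarrow> c"
      using compact_D unfolding compact_def by metis
    have ws: "Re (w (s n)) \<le> - real n" for n
      using w(2)[of "s n"] seq_suble[OF s(1), of n] by linarith
    have c: "c \<in> frontier D"
    proof (rule homeomorphism_seq_limit[OF hom, of "w \<circ> s"])
      fix v show "\<not> (w \<circ> s) \<longlonglongrightarrow> v"
        using Re_to_minus_infinity_diverges[of "w \<circ> s"] ws by simp
    qed (use w s in \<open>auto simp: o_def\<close>)
    have dca: "dist c a \<ge> \<epsilon>"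
    proof (rule tendsto_lowerbound)
      show "(\<lambda>n. dist (h (w (s n))) a) \<longlonglongrightarrow> dist c a" using s(2) by (intro tendsto_intros) (simp add: o_def)
    qed (use w(3) in auto)
    obtain \<phi> where \<phi>: "arc \<phi>" "\<phi> 1 = c" "\<phi> ` {0..<1} \<subseteq> interior D"
      using accessible_inside[OF c] unfolding accessible_from_def by blast
    have cphi: "continuous_on {0..1} \<phi>" using \<phi>(1) by (simp add: arc_def path_def)
    then obtain \<delta> where \<delta>: "\<delta> > 0" "\<And>t. t \<in> {0..1} \<Longrightarrow> dist t 1 < \<delta> \<Longrightarrow> dist (\<phi> t) (\<phi> 1) < \<epsilon>/3"
      unfolding continuous_on_iff using e by (metis atLeastAtMost_iff order_refl zero_less_divide_iff zero_less_numeral zero_le_one)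
    \<comment> \<open>Half of \<open>\<delta>\<close> keeps the tail of the arc strictly inside the
      continuity range, hence within a third of \<open>\<epsilon>\<close> of
      \<open>c\<close>.\<close>
    define t0 where "t0 = max 0 (1 - \<delta>/2)"
    have t0: "0 \<le> t0" "t0 < 1" using \<delta>(1) by (auto simp: t0_def)
    define T where "T = \<phi> ` {t0..<1}"
    have T: "T \<subseteq> ball c (\<epsilon>/3)"
      using \<delta>(2) \<phi>(2) \<delta>(1) t0 unfolding T_def t0_def by (force simp: dist_commute dist_real_def)
    have TD: "T \<subseteq> interior D" using \<phi>(3) t0 unfolding T_def by fastforce
    have connT: "connected T" unfolding T_def
      using t0 by (intro connected_continuous_image continuous_on_subset[OF cphi] convex_connected) auto
    have cT: "c \<in> closure T"
    proof -
      have "\<phi> ` closure {t0..<1} \<subseteq> closure T"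
        unfolding T_def using t0 by (intro image_closure_subset continuous_on_subset[OF cphi]) (auto simp: closure_subset)
      moreover have "1 \<in> closure {t0..<1}" using t0 by simp
      ultimately show ?thesis using \<phi>(2) by blast
    qed
    have "\<forall>\<^sub>F n in sequentially. dist (p (r n) (1/2)) a < \<epsilon>/3"
      using tendstoD[OF r(2), of "\<epsilon>/3"] e by (simp add: o_def)
    moreover have "\<forall>\<^sub>F n in sequentially. 1 / real (Suc n) < \<epsilon>/3"
      using e LIMSEQ_inverse_real_of_nat[THEN order_tendstoD(2), of "\<epsilon>/3"] by (simp add: inverse_eq_divide)
    moreover have "\<forall>\<^sub>F n in sequentially. - real n < Re (k (\<phi> t0))" by real_asymp
    ultimately have "\<forall>\<^sub>F n in sequentially. dist (p (r n) (1/2)) a < \<epsilon>/3 \<and> 1 / real (Suc n) < \<epsilon>/3 \<and> - real n < Re (k (\<phi> t0))"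
      by (intro eventually_conj)
    then obtain n where n: "dist (p (r n) (1/2)) a < \<epsilon>/3" "1 / real (Suc n) < \<epsilon>/3" "- real n < Re (k (\<phi> t0))"
      using eventually_happens'[OF sequentially_bot] by blast
    define m where "m = r n"
    have "n \<le> m" unfolding m_def using r(1) by (rule seq_suble)
    then have m: "dist (p m (1/2)) a < \<epsilon>/3" "1 / real (Suc m) < \<epsilon>/3" "x m < Re (k (\<phi> t0))"
    proof -
      show "dist (p m (1/2)) a < \<epsilon>/3" using n(1) by (simp add: m_def)
      have "1 / real (Suc m) \<le> 1 / real (Suc n)" using \<open>n \<le> m\<close> by (simp add: frac_le)
      then show "1 / real (Suc m) < \<epsilon>/3" using n(2) by linarith
      show "x m < Re (k (\<phi> t0))" using x[of m] n(3) \<open>n \<le> m\<close> by linarith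
    qed
    \<comment> \<open>The points \<open>c\<close> and \<open>a\<close> are at least
      \<open>\<epsilon>\<close> apart; the midpoint and the radius of the crosscut each use up less
      than a third.\<close>
    have far: "dist z c \<ge> \<epsilon>/3" if "z \<in> path_image (p m)" for z
    proof -
      have "dist (p m (1/2)) z \<le> 1 / real (Suc m)" using pc[of m] that by auto
      then show ?thesis using m(1,2) dca dist_triangle[of c a z] dist_triangle[of z a "p m (1/2)"]
        by (simp add: dist_commute)
    qed
    have "T \<inter> path_image (p m) = {}" using T far by (force simp: dist_commute)
    then have TLR: "T \<subseteq> L (x m) \<union> R (x m)" using cov[of m] TD by blast
    have LRdisj: "L (x m) \<inter> R (x m) = {}" unfolding L_def R_def by (subst inj_on_image_Int[OF inj, symmetric]) auto
    have "\<phi> t0 \<in> T" using t0 by (auto simp: T_def)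
    \<comment> \<open>The start of the tail is a fixed point of the strip, and \<open>x m\<close>
      lies below \<open>- m\<close>, so this crosscut has already passed to its left. Connectedness
      then carries the whole tail to the right side.\<close>
    have "\<phi> t0 \<in> R (x m)"
    proof -
      have "k (\<phi> t0) \<in> strip" "h (k (\<phi> t0)) = \<phi> t0"
        using hom \<open>\<phi> t0 \<in> T\<close> TD by (metis homeomorphism_def imageI subsetD)+
      then show ?thesis unfolding R_def using m(3) by (metis (mono_tags, lifting) image_eqI mem_Collect_eq)
    qed
    then have "T \<subseteq> R (x m)"
    proof -
      have "L (x m) \<inter> R (x m) \<inter> T = {}" using LRdisj by blast
      from connectedD[OF connT openLR[of "x m"] this TLR] show ?thesis
        using TLR \<open>\<phi> t0 \<in> T\<close> \<open>\<phi> t0 \<in> R (x m)\<close> by blast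
    qed
    then have "c \<in> closure (R (x m))" using cT closure_mono by blast
    \<comment> \<open>The bad sequence escapes to the left, so all but finitely many of its points
      are beyond this crosscut.\<close>
    moreover have "c \<in> closure (L (x m))"
    proof -
      obtain N where N: "- real N < x m" using reals_Archimedean2[of "- x m"] by (metis minus_less_iff)
      have "h (w (s (i + N))) \<in> L (x m)" for i
        using ws[of "i+N"] N w(1) by (auto simp: L_def)
      moreover have "(\<lambda>i. h (w (s (i + N)))) \<longlonglongrightarrow> c" using LIMSEQ_ignore_initial_segment[OF s(2), of N] by simp
      ultimately show ?thesis
        unfolding closure_sequential by (intro exI[of _ "\<lambda>i. h (w (s (i + N)))"]) simp
    qed
    ultimately have "c \<in> path_image (p m)" using sep by blast
    then show False using far e by force
  qed
  moreover have "a \<in> frontier D"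
  proof (rule homeomorphism_seq_limit[OF hom, of "\<lambda>n. of_real (- real n)"])
    show "of_real (- real n) \<in> strip" for n by simp
    show "(\<lambda>n. h (of_real (- real n))) \<longlonglongrightarrow> a"
    proof (rule LIMSEQ_I)
      fix e :: real assume "e > 0"
      then obtain X where X: "\<forall>w\<in>strip. Re w < X \<longrightarrow> dist (h w) a < e" using lim by blast
      obtain N where "real N > - X" using reals_Archimedean2 by blast
      then show "\<exists>no. \<forall>n\<ge>no. norm (h (of_real (- real n)) - a) < e"
        using X by (intro exI[of _ N]) (auto simp: dist_norm)
    qed
    fix v show "\<not> (\<lambda>n. complex_of_real (- real n)) \<longlonglongrightarrow> v"
      using Re_to_minus_infinity_diverges[of "\<lambda>n. complex_of_real (- real n)"] by simp
  qed
  ultimately show ?thesis using that by blast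
qed

end

section \<open>Logarithmic coordinates at a point of the circle\<close>

lemma strip_homeomorphic_disc:
  assumes z0: "cmod \<zeta> = 1"
  obtains m m' where "m holomorphic_on strip" "homeomorphism strip (ball 0 1) m m'"
    "\<And>X. \<exists>\<delta>>0. \<forall>z\<in>ball 0 1. dist z \<zeta> < \<delta> \<longrightarrow> Re (m' z) < X"
proof -
  \<comment> \<open>Composition of \<open>exp\<close>, from the strip onto the right half-plane,
    with the Moebius map of the half-plane onto the disc that sends 0 to \<open>\<zeta>\<close>. The
    inverse uses the principal logarithm.\<close>
  define m where "m w = \<zeta> * (1 - exp w) / (1 + exp w)" for w
  define m' where "m' z = Ln ((\<zeta> - z) / (\<zeta> + z))" for z
  have exp_pos: "Re (exp w) > 0" if "w \<in> strip" for w
    using that by (simp add: Re_exp cos_gt_zero_pi)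
  have ne: "1 + exp w \<noteq> 0" if "w \<in> strip" for w
    using exp_pos[OF that] by (metis add.commute add_eq_0_iff not_less_iff_gr_or_eq one_complex.simps(1) uminus_complex.simps(1) less_minus_one_simps(1) less_trans)
  have zne: "\<zeta> + z \<noteq> 0" if "z \<in> ball 0 1" for z
    using that z0 by (metis add.inverse_inverse add_eq_0_iff2 dist_0_norm less_irrefl mem_ball norm_minus_cancel)
  have zne2: "\<zeta> - z \<noteq> 0" if "z \<in> ball 0 1" for z
    using that z0 by auto
  have q: "Re ((\<zeta> - z) / (\<zeta> + z)) > 0" if "z \<in> ball 0 1" for z
  proof -
    have "Re ((\<zeta> - z) / (\<zeta> + z)) = ((cmod \<zeta>)\<^sup>2 - (cmod z)\<^sup>2) / (cmod (\<zeta> + z))\<^sup>2"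
      unfolding Re_divide cmod_power2 by (simp add: power2_eq_square algebra_simps)
    moreover have "(cmod z)\<^sup>2 < 1" using that by (simp add: power_less_one_iff)
    ultimately show ?thesis using z0 zne[OF that] by simp
  qed
  have mball: "m w \<in> ball 0 1" if "w \<in> strip" for w
  proof -
    have "(cmod (1 - exp w))\<^sup>2 < (cmod (1 + exp w))\<^sup>2"
      unfolding cmod_power2 using exp_pos[OF that] by (simp add: power2_eq_square algebra_simps)
    then have "cmod (1 - exp w) < cmod (1 + exp w)" by (rule power_less_imp_less_base) simp
    then show ?thesis using z0 ne[OF that] by (simp add: m_def norm_mult norm_divide)
  qed
  have m'strip: "m' z \<in> strip" if "z \<in> ball 0 1" for z
    using q[OF that] zne[OF that] zne2[OF that] Re_Ln_pos_lt by (simp add: m'_def)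
  have m'm: "m' (m w) = w" if "w \<in> strip" for w
  proof -
    have zn: "\<zeta> \<noteq> 0" using z0 by auto
    have n: "\<zeta> + m w \<noteq> 0" using zne mball that by blast
    have e: "\<zeta> - m w = \<zeta> * 2 * exp w / (1 + exp w)" "\<zeta> + m w = \<zeta> * 2 / (1 + exp w)"
      using ne[OF that] by (simp_all add: m_def field_simps)
    have "(\<zeta> - m w) / (\<zeta> + m w) = exp w" unfolding e using ne[OF that] zn by simp
    then show ?thesis using that pi_gt_zero unfolding m'_def by (auto intro!: Ln_exp)
  qed
  have mm': "m (m' z) = z" if "z \<in> ball 0 1" for z
  proof -
    have zn: "\<zeta> \<noteq> 0" using z0 by auto
    have "exp (m' z) = (\<zeta> - z) / (\<zeta> + z)" using zne[OF that] zne2[OF that] by (simp add: m'_def)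
    moreover have "1 - (\<zeta> - z) / (\<zeta> + z) = 2 * z / (\<zeta> + z)" "1 + (\<zeta> - z) / (\<zeta> + z) = 2 * \<zeta> / (\<zeta> + z)"
      using zne[OF that] by (simp_all add: field_simps)
    ultimately show ?thesis using zn zne[OF that] by (simp add: m_def)
  qed
  have mhol: "m holomorphic_on strip" unfolding m_def using ne by (intro holomorphic_intros) auto
  have "(\<zeta> - z) / (\<zeta> + z) \<notin> \<real>\<^sub>\<le>\<^sub>0" if "z \<in> ball 0 1" for z
    using q[OF that] by (auto simp: complex_nonpos_Reals_iff)
  then have m'cont: "continuous_on (ball 0 1) m'" unfolding m'_def using zne
    by (intro continuous_intros) blast+
  show thesis
  proof
    show "m holomorphic_on strip" by fact
    have "m ` strip = ball 0 1"
    proof (intro equalityI subsetI)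
      fix z :: complex assume "z \<in> ball 0 1"
      then show "z \<in> m ` strip" using mm' m'strip by (metis image_eqI)
    qed (use mball in blast)
    moreover have "m' ` ball 0 1 = strip"
    proof (intro equalityI subsetI)
      fix w assume "w \<in> strip"
      then show "w \<in> m' ` ball 0 1" using m'm mball by (metis image_eqI)
    qed (use m'strip in blast)
    ultimately show "homeomorphism strip (ball 0 1) m m'"
      unfolding homeomorphism_def using mhol m'cont m'm mm' holomorphic_on_imp_continuous_on by blast
    fix X
    show "\<exists>\<delta>>0. \<forall>z\<in>ball 0 1. dist z \<zeta> < \<delta> \<longrightarrow> Re (m' z) < X"
    proof (intro exI conjI ballI impI)
      \<comment> \<open>Distance below 1 from \<open>\<zeta>\<close> gives a denominator of modulus
        at least 1, so the quotient is bounded by the distance, and \<open>exp X\<close> bounds its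
        logarithm by \<open>X\<close>.\<close>
      show "min 1 (exp X) > 0" by simp
      fix z assume z: "z \<in> ball 0 1" "dist z \<zeta> < min 1 (exp X)"
      have "cmod (2 * \<zeta>) \<le> cmod (\<zeta> + z) + cmod (\<zeta> - z)" using norm_triangle_ineq[of "\<zeta> + z" "\<zeta> - z"] by simp
      then have ge: "cmod (\<zeta> + z) \<ge> 1" using z(2) z0 by (simp add: norm_mult dist_norm norm_minus_commute)
      have "cmod ((\<zeta> - z) / (\<zeta> + z)) \<le> cmod (\<zeta> - z)"
        unfolding norm_divide using ge by (simp add: divide_le_eq mult_left_le)
          (metis mult.commute mult_left_mono mult.right_neutral norm_ge_zero)
      also have "\<dots> < exp X" using z(2) by (simp add: dist_norm norm_minus_commute)
      finally have "ln (cmod ((\<zeta> - z) / (\<zeta> + z))) < ln (exp X)"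
        using zne[OF z(1)] zne2[OF z(1)] by (intro ln_strict_mono) auto
      then show "Re (m' z) < X" using zne[OF z(1)] zne2[OF z(1)] by (simp add: m'_def)
    qed
  qed
qed

section \<open>Continuous extension to the closed disc\<close>

text \<open>Limits along \<open>S\<close> alone suffice: a value \<open>F y\<close> is compared with
  \<open>F x\<close> through \<open>f z\<close> for some \<open>z\<close> in \<open>S\<close> close
  to \<open>y\<close>.\<close>

lemma continuous_extension_to_closure:
  fixes f F :: "'a::metric_space \<Rightarrow> 'b::metric_space"
  assumes F: "\<And>x e. x \<in> closure S \<Longrightarrow> e > 0 \<Longrightarrow> \<exists>d>0. \<forall>z\<in>S. dist z x < d \<longrightarrow> dist (f z) (F x) < e"
  shows "continuous_on (closure S) F"
  unfolding continuous_on_iff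
proof (intro ballI allI impI)
  fix x and e :: real assume x: "x \<in> closure S" and e: "e > 0"
  obtain d where d: "d > 0" "\<And>z. z \<in> S \<Longrightarrow> dist z x < d \<Longrightarrow> dist (f z) (F x) < e/2"
    using F[OF x, of "e/2"] e by auto
  show "\<exists>d>0. \<forall>y\<in>closure S. dist y x < d \<longrightarrow> dist (F y) (F x) < e"
  proof (intro exI conjI ballI impI)
    show "d/2 > 0" using d by simp
    fix y assume y: "y \<in> closure S" "dist y x < d/2"
    obtain d' where d': "d' > 0" "\<And>z. z \<in> S \<Longrightarrow> dist z y < d' \<Longrightarrow> dist (f z) (F y) < e/2"
      using F[OF y(1), of "e/2"] e by auto
    obtain z where z: "z \<in> S" "dist z y < min d' (d/2)"
      using y(1) d(1) d'(1) unfolding closure_approachable by (metis half_gt_zero min_less_iff_conj)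
    have "dist z x < d" using z(2) y(2) dist_triangle[of z x y] by simp
    then have "dist (f z) (F x) < e/2" "dist (f z) (F y) < e/2" using d(2) d'(2) z by auto
    then show "dist (F y) (F x) < e" using dist_triangle2[of "F y" "F x" "f z"] by (simp add: dist_commute)
  qed
qed

context biaccessible
begin

lemma disc_boundary_limit:
  assumes hol: "f holomorphic_on ball 0 1" and hom: "homeomorphism (ball 0 1) (interior D) f g"
    and z0: "cmod \<zeta> = 1"
  obtains a where "a \<in> frontier D" "\<And>e. e > 0 \<Longrightarrow> \<exists>d>0. \<forall>z\<in>ball 0 1. dist z \<zeta> < d \<longrightarrow> dist (f z) a < e"
proof -
  obtain m m' where m: "m holomorphic_on strip" "homeomorphism strip (ball 0 1) m m'"
    and lim: "\<And>X. \<exists>\<delta>>0. \<forall>z\<in>ball 0 1. dist z \<zeta> < \<delta> \<longrightarrow> Re (m' z) < X"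
    using strip_homeomorphic_disc[OF z0] by metis
  have "f \<circ> m holomorphic_on strip"
    using m hol by (intro holomorphic_on_compose) (simp_all add: homeomorphism_def)
  from strip_end_limit[OF this homeomorphism_compose[OF m(2) hom]]
  obtain a where a: "a \<in> frontier D"
     "\<And>\<epsilon>. \<epsilon> > 0 \<Longrightarrow> \<exists>X. \<forall>w\<in>strip. Re w < X \<longrightarrow> dist ((f \<circ> m) w) a < \<epsilon>" by metis
  show thesis
  proof (rule that[OF a(1)])
    fix e :: real assume "e > 0"
    then obtain X where X: "\<And>w. w \<in> strip \<Longrightarrow> Re w < X \<Longrightarrow> dist (f (m w)) a < e" using a(2) by (metis comp_apply)
    obtain d where d: "d > 0" "\<And>z. z\<in>ball 0 1 \<Longrightarrow> dist z \<zeta> < d \<Longrightarrow> Re (m' z) < X" using lim by metis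
    have "dist (f z) a < e" if "z \<in> ball 0 1" "dist z \<zeta> < d" for z
    proof -
      have "m' z \<in> strip" "m (m' z) = z" using m(2) that(1) by (metis homeomorphism_def imageI)+
      then show ?thesis using X d(2)[OF that] by metis
    qed
    then show "\<exists>d>0. \<forall>z\<in>ball 0 1. dist z \<zeta> < d \<longrightarrow> dist (f z) a < e" using d(1) by blast
  qed
qed

lemma disc_map_extends:
  assumes hol: "f holomorphic_on ball 0 1" and hom: "homeomorphism (ball 0 1) (interior D) f g"
  obtains F where "continuous_on (cball 0 1) F" "\<And>z. z \<in> ball 0 1 \<Longrightarrow> F z = f z"
    "F ` sphere 0 1 \<subseteq> frontier D" "F ` cball 0 1 = D"
proof -
  let ?lim = "\<lambda>x a. \<forall>e>0. \<exists>d>0. \<forall>z\<in>ball 0 1. dist z x < d \<longrightarrow> dist (f z) a < e"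
  have "\<exists>a. (cmod x < 1 \<longrightarrow> a = f x) \<and> (cmod x = 1 \<longrightarrow> a \<in> frontier D) \<and> (cmod x \<le> 1 \<longrightarrow> ?lim x a)" for x
  proof -
    consider "cmod x < 1" | "cmod x = 1" | "cmod x > 1" by linarith
    then show ?thesis
    proof cases
      case 1
      moreover have "?lim x (f x)"
        using holomorphic_on_imp_continuous_on[OF hol] 1 unfolding continuous_on_iff by simp
      ultimately show ?thesis by (intro exI[of _ "f x"]) auto
    next
      case 2
      obtain a where "a \<in> frontier D" "\<And>e. e > 0 \<Longrightarrow> \<exists>d>0. \<forall>z\<in>ball 0 1. dist z x < d \<longrightarrow> dist (f z) a < e"
        using disc_boundary_limit[OF hol hom 2] by metis
      then show ?thesis using 2 by (intro exI[of _ a]) auto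
    qed auto
  qed
  then obtain F where F: "\<And>x. cmod x < 1 \<Longrightarrow> F x = f x" "\<And>x. cmod x = 1 \<Longrightarrow> F x \<in> frontier D"
      "\<And>x. cmod x \<le> 1 \<Longrightarrow> ?lim x (F x)" by metis
  have clb: "closure (ball 0 1 :: complex set) = cball 0 1" by simp
  have cont: "continuous_on (cball 0 1) F"
    unfolding clb[symmetric] by (rule continuous_extension_to_closure[where f=f]) (use F(3) in \<open>simp add: clb\<close>)
  have Fball: "F ` ball 0 1 = interior D"
  proof -
    have "F ` ball 0 1 = f ` ball 0 1" by (rule image_cong) (use F(1) in auto)
    then show ?thesis using hom by (simp add: homeomorphism_def)
  qed
  \<comment> \<open>Surjectivity without tracing boundary points: the image is compact and contains
    \<open>interior D\<close>, hence its closure.\<close>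
  have "interior D \<subseteq> F ` cball 0 1" unfolding Fball[symmetric] by (rule image_mono) (rule ball_subset_cball)
  moreover have "closed (F ` cball 0 1)" using cont by (simp add: compact_continuous_image compact_imp_closed)
  ultimately have sub: "closure (interior D) \<subseteq> F ` cball 0 1" by (rule closure_minimal)
  have "D \<subseteq> closure (interior D)"
  proof
    fix x assume "x \<in> D"
    show "x \<in> closure (interior D)"
    proof (cases "x \<in> interior D")
      case True then show ?thesis using closure_subset by blast
    next
      case False
      with \<open>x \<in> D\<close> have "x \<in> frontier D" using closure_subset unfolding frontier_def by blast
      \<comment> \<open>Accessibility from inside contains the assertion that the point lies on the
        frontier of \<open>interior D\<close>, so \<open>D\<close> has no points away from the
        closure of its interior.\<close>
      then have "x \<in> frontier (interior D)" using accessible_inside unfolding accessible_from_def by blast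
      then show ?thesis by (simp add: frontier_def)
    qed
  qed
  moreover have "F ` cball 0 1 \<subseteq> D"
  proof -
    have "cball 0 1 = ball 0 1 \<union> (sphere 0 1 :: complex set)" by auto
    moreover have "F ` sphere 0 1 \<subseteq> D"
      using F(2) frontier_subset_closed[OF compact_imp_closed[OF compact_D]] by auto
    ultimately show ?thesis using Fball interior_subset by (metis image_Un Un_least)
  qed
  ultimately have Fc: "F ` cball 0 1 = D" using sub by blast
  have Fs: "F ` sphere 0 1 \<subseteq> frontier D" using F(2) by (intro image_subsetI) simp
  have Fb: "F z = f z" if "z \<in> ball 0 1" for z using F(1) that by simp
  show thesis by (rule that[OF cont Fb Fs Fc])
qed

end

section \<open>Injectivity on the circle\<close>

text \<open>Finitely many rotations of the arc cover the circle, so the product of the rotated functions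
  \<open>F - p\<close> vanishes on the whole circle.\<close>
lemma constant_on_boundary_arc:
  fixes F :: "complex \<Rightarrow> complex"
  assumes cont: "continuous_on (cball 0 1) F" and hol: "F holomorphic_on ball 0 1"
    and U: "open U" "U \<inter> sphere 0 1 \<noteq> {}" and const: "\<And>z. z \<in> U \<inter> sphere 0 1 \<Longrightarrow> F z = p"
  shows "F 0 = p"
proof -
  obtain z0 where z0: "z0 \<in> U" "cmod z0 = 1" using U(2) by auto
  have opn: "open ((\<lambda>z. z / u) -` U)" for u :: complex
    using U(1) by (rule open_vimage) (cases "u = 0"; auto intro!: continuous_intros)
  \<comment> \<open>The rotation \<open>u = z / z0\<close> moves \<open>z\<close> back to the chosen
    point \<open>z0\<close> of the arc.\<close>
  have "sphere 0 1 \<subseteq> (\<Union>u\<in>sphere 0 1. (\<lambda>z. z / u) -` U)"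
  proof
    fix z :: complex assume "z \<in> sphere 0 1"
    then have "z / z0 \<in> sphere 0 1" "z / (z / z0) \<in> U" using z0 by (auto simp: norm_divide)
    then show "z \<in> (\<Union>u\<in>sphere 0 1. (\<lambda>z. z / u) -` U)" by blast
  qed
  then obtain I where I: "I \<subseteq> sphere 0 1" "finite I" "sphere 0 1 \<subseteq> (\<Union>u\<in>I. (\<lambda>z. z / u) -` U)"
    using compactE_image[OF compact_sphere, of "sphere 0 1" "\<lambda>u. (\<lambda>z. z / u) -` U"] opn by metis
  define H where "H z = (\<Prod>u\<in>I. F (z / u) - p)" for z
  have Iu: "cmod u = 1" "u \<noteq> 0" if "u \<in> I" for u using I(1) that by auto
  have "norm (H 0) \<le> 0"
  \<comment> \<open>The bound 0 on the circle passes to the centre, which all rotations fix: there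
    every factor is \<open>F 0 - p\<close>.\<close>
  proof (rule maximum_modulus_frontier[where f=H and S="ball 0 1"])
    have "(\<lambda>z. F (z / u)) holomorphic_on ball 0 1" if "u \<in> I" for u
    proof -
      have "F \<circ> (\<lambda>z. z / u) holomorphic_on ball 0 1"
        using Iu[OF that] by (intro holomorphic_on_compose_gen[OF _ hol] holomorphic_intros) (auto simp: norm_divide)
      then show ?thesis by (simp add: o_def)
    qed
    then show "H holomorphic_on interior (ball 0 1)"
      unfolding H_def by (auto intro!: holomorphic_intros)
    have "continuous_on (cball 0 1) (\<lambda>z. F (z / u))" if "u \<in> I" for u
      using Iu[OF that] by (intro continuous_on_compose2[OF cont] continuous_intros) (auto simp: norm_divide)
    then show "continuous_on (closure (ball 0 1)) H"
      unfolding H_def by (auto intro!: continuous_intros)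
    fix z assume "z \<in> frontier (ball (0::complex) 1)"
    then have z: "z \<in> sphere 0 1" by simp
    then obtain u where u: "u \<in> I" "z / u \<in> U" using I(3) by blast
    then have "z / u \<in> U \<inter> sphere 0 1" using z Iu[OF u(1)] by (simp add: norm_divide)
    then have "F (z / u) - p = 0" using const by simp
    then have "H z = 0" unfolding H_def using u(1) I(2) by (metis prod_zero_iff)
    then show "norm (H z) \<le> 0" by simp
  qed auto
  then show ?thesis using I(2) by (auto simp: H_def)
qed

lemma inner_chord:
  fixes z1 d :: complex
  assumes "cmod z1 = 1" "cmod (z1 + d) = 1"
  shows "2 * inner d z1 = - (cmod d)\<^sup>2"
proof -
  have "(cmod (z1 + d))\<^sup>2 = (cmod z1)\<^sup>2 + 2 * inner d z1 + (cmod d)\<^sup>2"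
    unfolding cmod_power2 inner_complex_def by (simp add: power2_eq_square algebra_simps)
  then show ?thesis using assms by simp
qed

text \<open>\<open>n\<close> is the chord direction turned by a right angle. As \<open>z1\<close>
  has a nonzero component along the chord, Pythagoras gives |<n, z1>| < |n|, and the unit vectors in
  directions \<open>n\<close> and \<open>- n\<close> lie strictly on the two sides.\<close>

lemma halfplane_meets_unit_circle:
  fixes z1 z2 :: complex
  assumes "cmod z1 = 1" "cmod z2 = 1" "z1 \<noteq> z2"
  defines "n \<equiv> \<i> * (z2 - z1)"
  shows "{z. inner n z < inner n z1} \<inter> sphere 0 1 \<noteq> {}" "{z. inner n z > inner n z1} \<inter> sphere 0 1 \<noteq> {}"
proof -
  define d where "d = z2 - z1"
  have dn: "cmod d > 0" using assms(3) by (simp add: d_def)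
  have ip: "2 * inner d z1 = - (cmod d)\<^sup>2"
    using inner_chord[of z1 d] assms(1,2) by (simp add: d_def)
  have "(inner d z1)\<^sup>2 + (inner n z1)\<^sup>2 = (cmod z1)\<^sup>2 * (cmod d)\<^sup>2"
    unfolding n_def d_def[symmetric] cmod_power2 inner_complex_def by (simp add: power2_eq_square algebra_simps)
  moreover have "(inner d z1)\<^sup>2 > 0" using ip dn by auto
  ultimately have "(inner n z1)\<^sup>2 < (cmod d)\<^sup>2" unfolding assms(1) power_one mult_1_left by linarith
  then have b: "\<bar>inner n z1\<bar> < cmod d" by (metis abs_le_square_iff abs_norm_cancel not_less)
  define v where "v = n /\<^sub>R cmod d"
  have nn: "cmod n = cmod d" by (simp add: n_def d_def norm_mult)
  then have "cmod v = 1" "inner n v = cmod d"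
    using dn by (simp_all add: v_def inner_mult_right dot_square_norm power2_eq_square)
  then have "v \<in> {z. inner n z > inner n z1} \<inter> sphere 0 1" "- v \<in> {z. inner n z < inner n z1} \<inter> sphere 0 1"
    using b by (auto simp: abs_less_iff)
  then show "{z. inner n z < inner n z1} \<inter> sphere 0 1 \<noteq> {}" "{z. inner n z > inner n z1} \<inter> sphere 0 1 \<noteq> {}" by blast+
qed

text \<open>With \<open>d = z2 - z1\<close>, the squared modulus at parameter t is 1 + |d|^2 t (t -
  1), which is below 1 exactly for t strictly between 0 and 1.\<close>

lemma chord_in_disc:
  fixes z1 z2 :: complex
  assumes "cmod z1 = 1" "cmod z2 = 1" "z1 \<noteq> z2"
  defines "n \<equiv> \<i> * (z2 - z1)"
  shows "linepath z1 z2 ` {0<..<1} = ball 0 1 \<inter> {z. inner n z = inner n z1}"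
proof -
  define d where "d = z2 - z1"
  have dn: "d \<noteq> 0" using assms(3) by (simp add: d_def)
  have lin: "linepath z1 z2 t = z1 + of_real t * d" for t
    by (simp add: linepath_def d_def scaleR_conv_of_real algebra_simps)
  have ip: "2 * inner d z1 = - (cmod d)\<^sup>2"
    using inner_chord[of z1 d] assms(1,2) by (simp add: d_def)
  have sq: "(cmod (z1 + of_real t * d))\<^sup>2 = 1 + (cmod d)\<^sup>2 * (t * (t - 1))" for t
  proof -
    have "(cmod (z1 + of_real t * d))\<^sup>2 = (cmod z1)\<^sup>2 + t * (2 * inner d z1) + t\<^sup>2 * (cmod d)\<^sup>2"
      unfolding cmod_power2 inner_complex_def by (simp add: power2_eq_square algebra_simps)
    then show ?thesis unfolding ip using assms(1) by (simp add: power2_eq_square algebra_simps)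
  qed
  have inb: "z1 + of_real t * d \<in> ball 0 1 \<longleftrightarrow> t \<in> {0<..<1}" for t
  proof -
    have "z1 + of_real t * d \<in> ball 0 1 \<longleftrightarrow> (cmod (z1 + of_real t * d))\<^sup>2 < 1"
      by (simp add: power_less_one_iff abs_square_less_1)
    also have "\<dots> \<longleftrightarrow> t * (t - 1) < 0" unfolding sq using dn by (simp add: mult_less_0_iff)
    also have "\<dots> \<longleftrightarrow> t \<in> {0<..<1}" by (auto simp: mult_less_0_iff)
    finally show ?thesis .
  qed
  show ?thesis
  proof (intro equalityI subsetI)
    fix z assume "z \<in> linepath z1 z2 ` {0<..<1}"
    then obtain t where t: "t \<in> {0<..<1}" "z = z1 + of_real t * d" using lin by auto
    then have "inner n z = inner n z1"
      unfolding n_def d_def[symmetric] inner_complex_def by (simp add: algebra_simps)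
    then show "z \<in> ball 0 1 \<inter> {z. inner n z = inner n z1}" using inb t by auto
  next
    fix z assume z: "z \<in> ball 0 1 \<inter> {z. inner n z = inner n z1}"
    have im: "Im ((z - z1) / d) = 0"
      using z unfolding Im_divide n_def d_def[symmetric] inner_complex_def by (simp add: algebra_simps)
    define t where "t = Re ((z - z1) / d)"
    have "(z - z1) / d = of_real t" using im by (simp add: complex_eq_iff t_def)
    then have zt: "z = z1 + of_real t * d" using dn by (simp add: field_simps)
    then have "t \<in> {0<..<1}" using inb z by blast
    then show "z \<in> linepath z1 z2 ` {0<..<1}" unfolding zt lin[symmetric] by (rule imageI)
  qed
qed

lemma connected_Int_Jordan:
  fixes j :: "real \<Rightarrow> complex"
  assumes "simple_path j" "pathfinish j = pathstart j" "connected C" "C \<inter> path_image j = {}" "\<not> bounded C"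
  shows "C \<inter> inside (path_image j) = {}"
proof -
  let ?I = "inside (path_image j)" and ?O = "outside (path_image j)"
  have JJ: "open ?I" "open ?O" "?I \<inter> ?O = {}" "?I \<union> ?O = - path_image j" "bounded ?I"
    using Jordan_inside_outside[OF assms(1,2)] by auto
  have cov: "C \<subseteq> ?I \<union> ?O" using JJ(4) assms(4) by blast
  have "?O \<inter> C \<noteq> {}"
  proof
    assume "?O \<inter> C = {}"
    then have "C \<subseteq> ?I" using cov by blast
    then show False using JJ(5) assms(5) bounded_subset by blast
  qed
  moreover have "?I \<inter> ?O \<inter> C = {}" using JJ(3) by blast
  ultimately show ?thesis using connectedD[OF assms(3) JJ(1,2) _ cov] by blast
qed

context biaccessible
begin

text \<open>The chord leaves a half of the disc on each side, and one of them is mapped inside the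
  Jordan curve; its boundary arc has nowhere to go but the single frontier point of that
  curve.\<close>

lemma disc_map_inj_on_circle:
  assumes cont: "continuous_on (cball 0 1) F" and hol: "F holomorphic_on ball 0 1"
    and injF: "inj_on F (ball 0 1)" and Fball: "F ` ball 0 1 = interior D" and Fsph: "F ` sphere 0 1 \<subseteq> frontier D"
  shows "inj_on F (sphere 0 1)"
proof (rule inj_onI, rule ccontr)
  fix z1 z2 assume "z1 \<in> sphere 0 1" "z2 \<in> sphere 0 1" and Feq: "F z1 = F z2" and ne: "z1 \<noteq> z2"
  then have z: "cmod z1 = 1" "cmod z2 = 1" by auto
  define n where "n = \<i> * (z2 - z1)"
  define j where "j = F \<circ> linepath z1 z2"
  define L where "L = {z. inner n z < inner n z1}"
  define R where "R = {z. inner n z > inner n z1}"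
  have chord: "linepath z1 z2 ` {0<..<1} = ball 0 1 \<inter> {z. inner n z = inner n z1}"
    unfolding n_def using chord_in_disc[OF z ne] .
  have fi: "frontier D \<inter> interior D = {}" by (auto simp: frontier_def)
  have pj: "path j"
    unfolding j_def
  proof (rule path_continuous_image)
    have "closed_segment z1 z2 \<subseteq> cball 0 1" using z by (intro closed_segment_subset) auto
    then show "continuous_on (path_image (linepath z1 z2)) F" using cont continuous_on_subset by (metis path_image_linepath)
  qed simp
  have j01: "j 0 = F z1" "j 1 = F z1" by (simp_all add: j_def linepath_def Feq)
  have p: "F z1 \<in> frontier D" using Fsph z by auto
  have jin: "j ` {0<..<1} = F ` (ball 0 1 \<inter> {z. inner n z = inner n z1})"
    unfolding j_def image_comp[symmetric] chord ..
  then have jD: "j ` {0<..<1} \<subseteq> interior D" using Fball by blast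
  have injj: "inj_on j {0<..<1}"
  proof -
    have "inj_on (linepath z1 z2) {0<..<1}" using ne arc_linepath[of z1 z2] by (auto simp: arc_def intro: inj_on_subset)
    moreover have "inj_on F (linepath z1 z2 ` {0<..<1})" unfolding chord using injF by (rule inj_on_subset) auto
    ultimately show ?thesis unfolding j_def by (rule comp_inj_on)
  qed
  have u: "{0..1} = {0, 1} \<union> {0<..<1::real}" by auto
  have pim: "path_image j = insert (F z1) (j ` {0<..<1})" unfolding path_image_def u by (simp add: j01)
  have "F z1 \<notin> interior D" using p fi by blast
  then have "loop_free j" using jD injj j01 by (intro loop_free_if_endpoints_outside[where A="interior D"]) simp_all
  then have sj: "simple_path j" using pj by (simp add: simple_path_def)
  have cj: "pathfinish j = pathstart j" by (simp add: pathfinish_def pathstart_def j01)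
  let ?I = "inside (path_image j)"
  have JJ: "open ?I" "closure ?I = ?I \<union> path_image j"
    using Jordan_inside_outside[OF sj cj] by (auto simp: closure_Un_frontier)
  have intj: "path_image j \<inter> interior D = j ` {0<..<1}"
    unfolding pim using jD p fi by blast
  have frj: "path_image j \<inter> frontier D = {F z1}"
    unfolding pim using jD p fi by blast
  have jsub: "path_image j \<subseteq> D"
    unfolding pim using jD p interior_subset frontier_subset_closed[OF compact_imp_closed[OF compact_D]] by blast
  have disj: "F ` (ball 0 1 \<inter> A) \<inter> path_image j = {}" if "A \<inter> {z. inner n z = inner n z1} = {}" for A
  proof -
    have "F ` (ball 0 1 \<inter> A) \<inter> F ` (ball 0 1 \<inter> {z. inner n z = inner n z1}) = F ` ((ball 0 1 \<inter> A) \<inter> (ball 0 1 \<inter> {z. inner n z = inner n z1}))"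
      by (rule inj_on_image_Int[OF injF, symmetric]) auto
    also have "\<dots> = {}" using that by blast
    finally have "F ` (ball 0 1 \<inter> A) \<inter> j ` {0<..<1} = {}" unfolding jin .
    moreover have "F ` (ball 0 1 \<inter> A) \<subseteq> interior D" using Fball by blast
    ultimately show ?thesis using intj by blast
  qed
  have conn: "connected (F ` (ball 0 1 \<inter> A))" if "convex A" for A
  proof (rule connected_continuous_image)
    show "continuous_on (ball 0 1 \<inter> A) F" using cont by (rule continuous_on_subset) auto
    show "connected (ball 0 1 \<inter> A)" using that by (intro convex_connected convex_Int convex_ball)
  qed
  have sides: "F ` (ball 0 1 \<inter> L) \<subseteq> ?I \<and> F ` (ball 0 1 \<inter> R) \<subseteq> outside (path_image j) \<or>
     F ` (ball 0 1 \<inter> L) \<subseteq> outside (path_image j) \<and> F ` (ball 0 1 \<inter> R) \<subseteq> ?I"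
  proof (rule jordan_sides[OF sj cj, where G="interior D"])
    have "j (1/2) \<in> j ` {0<..<1}" by auto
    then show "interior D \<inter> path_image j \<noteq> {}" using intj by blast
    show "connected (F ` (ball 0 1 \<inter> L))" unfolding L_def by (intro conn convex_halfspace_lt)
    show "connected (F ` (ball 0 1 \<inter> R))" unfolding R_def by (intro conn convex_halfspace_gt)
    show "F ` (ball 0 1 \<inter> L) \<inter> path_image j = {}" "F ` (ball 0 1 \<inter> R) \<inter> path_image j = {}"
      by (rule disj; auto simp: L_def R_def)+
    have "ball 0 1 = (ball 0 1 \<inter> L) \<union> (ball 0 1 \<inter> R) \<union> (ball 0 1 \<inter> {z. inner n z = inner n z1})"
      unfolding L_def R_def by auto
    then have "interior D = F ` (ball 0 1 \<inter> L) \<union> F ` (ball 0 1 \<inter> R) \<union> j ` {0<..<1}"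
      unfolding Fball[symmetric] jin by (metis image_Un)
    then show "interior D - path_image j \<subseteq> F ` (ball 0 1 \<inter> L) \<union> F ` (ball 0 1 \<inter> R)" using intj by blast
  qed simp
  \<comment> \<open>The curve lies in \<open>D\<close>, so the connected unbounded set
    \<open>- D\<close> is entirely outside it.\<close>
  have "\<not> bounded (- D)" using compact_D by (simp add: cobounded_imp_unbounded compact_imp_bounded)
  then have outI: "- D \<inter> ?I = {}"
    using connected_Int_Jordan[OF sj cj connected_outside] jsub by blast
  have contra: False if A: "open A" "F ` (ball 0 1 \<inter> A) \<subseteq> ?I" "A \<inter> sphere 0 1 \<noteq> {}" for A
  proof -
    have "F z = F z1" if z: "z \<in> A \<inter> sphere 0 1" for z
    proof -
      have "z \<in> closure (A \<inter> ball 0 1)"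
        using open_Int_closure_subset[OF A(1), of "ball 0 1"] z by auto
      moreover have "F ` closure (A \<inter> ball 0 1) \<subseteq> closure ?I"
      proof (rule image_closure_subset)
        have "closure (A \<inter> ball 0 1) \<subseteq> cball 0 1" by (intro closure_minimal) auto
        then show "continuous_on (closure (A \<inter> ball 0 1)) F" using cont continuous_on_subset by blast
        show "F ` (A \<inter> ball 0 1) \<subseteq> closure ?I" using A(2) closure_subset by (metis Int_commute order_trans)
      qed simp
      ultimately have "F z \<in> ?I \<union> path_image j" using JJ(2) by blast
      moreover have Fz: "F z \<in> frontier D" using z Fsph by blast
      \<comment> \<open>A frontier point of \<open>D\<close> is a limit of points of
        \<open>- D\<close>, none of which enter the open set \<open>?I\<close>. So
        \<open>F z\<close> is on the curve, where \<open>F z1\<close> is the only frontier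
        point.\<close>
      moreover have "F z \<notin> ?I"
      proof
        assume "F z \<in> ?I"
        moreover have "F z \<in> closure (- D)" using Fz by (simp add: frontier_closures)
        ultimately show False using outI JJ(1) by (metis Int_commute disjoint_iff open_Int_closure_eq_empty)
      qed
      ultimately show ?thesis using frj by blast
    qed
    then have "F 0 = F z1" using constant_on_boundary_arc[OF cont hol A(1,3)] by blast
    moreover have "F 0 \<in> interior D" using Fball by (metis centre_in_ball image_eqI zero_less_one)
    ultimately show False using p fi by (metis disjoint_iff)
  qed
  have "open L" "open R" unfolding L_def R_def by (simp_all add: open_halfspace_lt open_halfspace_gt)
  moreover have "L \<inter> sphere 0 1 \<noteq> {}" "R \<inter> sphere 0 1 \<noteq> {}"
    unfolding L_def R_def n_def using halfplane_meets_unit_circle[OF z ne] by auto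
  ultimately show False using contra[of L] contra[of R] sides by blast
qed

lemma homeomorphic_disc:
  assumes ne: "interior D \<noteq> {}"
  shows "D homeomorphic (cball 0 1 :: complex set)"
proof -
  have bd: "bounded (interior D)" using compact_D bounded_interior compact_imp_bounded by blast
  \<comment> \<open>For a bounded connected open set, simple connectivity amounts to a connected
    complement; here the complement is the closure of the connected set \<open>- D\<close>.\<close>
  have "closure (- D) = - interior D" by (simp add: interior_closure)
  then have "connected (- interior D)" using connected_outside connected_imp_connected_closure by metis
  then have "simply_connected (interior D)"
    using simply_connected_iff_simple[of "interior D"] bd connected_interior by simp
  moreover have "interior D \<noteq> UNIV" using bd not_bounded_UNIV by metis
  ultimately obtain g f where gf: "g holomorphic_on interior D" "f holomorphic_on ball 0 1"
     "\<And>z. z \<in> interior D \<Longrightarrow> g z \<in> ball 0 1 \<and> f (g z) = z"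
     "\<And>z. z \<in> ball 0 1 \<Longrightarrow> f z \<in> interior D \<and> g (f z) = z"
    using Riemann_mapping_theorem[of "interior D"] ne by (metis open_interior)
  have hom: "homeomorphism (ball 0 1) (interior D) f g"
    by (rule homeomorphismI) (use gf in \<open>auto simp: holomorphic_on_imp_continuous_on\<close>)
  obtain F where F: "continuous_on (cball 0 1) F" "\<And>z. z \<in> ball 0 1 \<Longrightarrow> F z = f z"
    "F ` sphere 0 1 \<subseteq> frontier D" "F ` cball 0 1 = D"
    using disc_map_extends[OF gf(2) hom] by metis
  have Fhol: "F holomorphic_on ball 0 1" using gf(2) F(2) by (metis holomorphic_cong)
  have Finj: "inj_on F (ball 0 1)" using F(2) gf(4) by (metis inj_onI)
  have Fball: "F ` ball 0 1 = interior D"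
  proof -
    have "F ` ball 0 1 = f ` ball 0 1" by (rule image_cong) (use F(2) in auto)
    then show ?thesis using hom by (simp add: homeomorphism_def)
  qed
  have "inj_on F (sphere 0 1)" by (rule disc_map_inj_on_circle[OF F(1) Fhol Finj Fball F(3)])
  moreover have "F ` ball 0 1 \<inter> F ` sphere 0 1 = {}" using Fball F(3) by (auto simp: frontier_def)
  ultimately have "inj_on F (ball 0 1 \<union> sphere 0 1)" using Finj by (auto simp: inj_on_Un)
  moreover have "ball 0 1 \<union> sphere 0 1 = cball (0::complex) 1" by auto
  ultimately show ?thesis using homeomorphic_compact[OF compact_cball F(1) F(4)] homeomorphic_sym by metis
qed

end

subsection \<open>Accessibility of the boundary of a disc from outside\<close>

text \<open>Chains of ever smaller connecting paths are concatenated to one path ending in the limit point.\<close>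
lemma accessible_from_locally_connected:
  fixes x :: "'a::euclidean_space"
  assumes U: "open U" and x: "x \<in> frontier U"
    and conn: "\<And>\<epsilon>. \<epsilon> > 0 \<Longrightarrow> \<exists>\<delta>>0. \<forall>p\<in>U \<inter> ball x \<delta>. \<forall>q\<in>U \<inter> ball x \<delta>. path_component (U \<inter> ball x \<epsilon>) p q"
  shows "accessible_from x U"
proof -
  have xU: "x \<notin> U" "x \<in> closure U" using x U by (auto simp: frontier_def interior_open)
  have "\<exists>\<delta>>0. \<forall>p\<in>U \<inter> ball x \<delta>. \<forall>q\<in>U \<inter> ball x \<delta>. path_component (U \<inter> ball x (1 / real (Suc n))) p q" for n
    by (rule conn) simp
  then obtain \<delta> where \<delta>: "\<And>n. \<delta> n > 0"
    "\<And>n p q. p \<in> U \<inter> ball x (\<delta> n) \<Longrightarrow> q \<in> U \<inter> ball x (\<delta> n) \<Longrightarrow> path_component (U \<inter> ball x (1 / real (Suc n))) p q"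
    by metis
  \<comment> \<open>The minimum over all earlier radii places \<open>p n\<close> and
    \<open>p (Suc n)\<close> both in the ball of radius \<open>\<delta> n\<close>, although
    \<open>\<delta>\<close> need not be monotone.\<close>
  have "\<exists>p. p \<in> U \<and> dist p x < Min (\<delta> ` {..n})" for n
  proof -
    have "Min (\<delta> ` {..n}) > 0" using \<delta>(1) by (subst Min_gr_iff) auto
    then show ?thesis using xU(2) unfolding closure_approachable by blast
  qed
  then obtain p where p: "\<And>n. p n \<in> U" "\<And>n. dist (p n) x < Min (\<delta> ` {..n})" by metis
  have pb: "p n \<in> U \<inter> ball x (\<delta> m)" if "m \<le> n" for m n
  proof -
    have "Min (\<delta> ` {..n}) \<le> \<delta> m" using that by (intro Min_le) auto
    then have "dist (p n) x < \<delta> m" by (rule less_le_trans[OF p(2)])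
    then show ?thesis using p(1) by (simp add: dist_commute)
  qed
  have "path_component (U \<inter> ball x (1 / real (Suc n))) (p n) (p (Suc n))" for n
    by (rule \<delta>(2)) (rule pb; simp)+
  then obtain g where g: "\<And>n. path (g n)" "\<And>n. path_image (g n) \<subseteq> U \<inter> ball x (1 / real (Suc n))"
    "\<And>n. g n 0 = p n" "\<And>n. g n 1 = p (Suc n)"
    unfolding path_component_def pathstart_def pathfinish_def by metis
  \<comment> \<open>The infinite concatenation: \<open>g n\<close> is run on the interval from
    \<open>n\<close> to \<open>n + 1\<close>.\<close>
  define q where "q t = g (nat \<lfloor>t\<rfloor>) (t - real (nat \<lfloor>t\<rfloor>))" for t :: real
  have q_eq: "q t = g n (t - real n)" if "t \<in> {real n..real (Suc n)}" for t n
  proof (cases "t = real (Suc n)")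
    case True
    then have "nat \<lfloor>t\<rfloor> = Suc n" by simp
    then show ?thesis unfolding q_def using True g(3)[of "Suc n"] g(4)[of n] by simp
  next
    case False
    then have "\<lfloor>t\<rfloor> = int n" using that by (intro floor_unique) auto
    then show ?thesis unfolding q_def by simp
  qed
  have q_in: "q t \<in> U \<inter> ball x (1 / real (Suc (nat \<lfloor>t\<rfloor>)))" if "t \<ge> 0" for t
  proof -
    have "t - real (nat \<lfloor>t\<rfloor>) \<in> {0..1}" using that by simp linarith
    then have "q t \<in> path_image (g (nat \<lfloor>t\<rfloor>))" unfolding q_def path_image_def by (rule imageI)
    then show ?thesis using g(2) by blast
  qed
  have q_seg: "continuous_on {real n..real (Suc n)} q" for n
  proof -
    have "continuous_on {real n..real (Suc n)} (\<lambda>t. g n (t - real n))"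
      using g(1)[of n] unfolding path_def
      by (rule continuous_on_compose2) (auto intro!: continuous_intros)
    then show ?thesis using q_eq by (metis (no_types, lifting) continuous_on_cong)
  qed
  have q_fin: "continuous_on {0..real n} q" for n
  proof (induction n)
    case (Suc n)
    have "{0..real (Suc n)} = {0..real n} \<union> {real n..real (Suc n)}" by auto
    then show ?case using continuous_on_closed_Un[OF _ _ Suc.IH q_seg[of n]] by simp
  qed simp
  \<comment> \<open>The substitution s / (1 - s) compresses the half-line to [0,1), leaving the
    parameter 1 for the limit point.\<close>
  define \<phi> where "\<phi> s = (if s < 1 then q (s / (1 - s)) else x)" for s :: real
  have \<phi>_in: "\<phi> s \<in> U" if "s \<in> {0..<1}" for s
    using q_in[of "s / (1 - s)"] that by (simp add: \<phi>_def)
  have \<phi>_init: "continuous_on {0..r} \<phi>" if "r < 1" for r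
  proof -
    obtain n where n: "r / (1 - r) \<le> real n" using real_arch_simple by blast
    have "s / (1 - s) \<in> {0..real n}" if s: "s \<in> {0..r}" for s
    proof -
      have "s / (1 - s) \<le> r / (1 - r)" using s \<open>r < 1\<close> by (intro frac_le) auto
      then show ?thesis using n s \<open>r < 1\<close> by simp
    qed
    then have "continuous_on {0..r} (\<lambda>s. q (s / (1 - s)))"
      using \<open>r < 1\<close> by (intro continuous_on_compose2[OF q_fin[of n]] continuous_intros) auto
    then show ?thesis using \<open>r < 1\<close> by (subst continuous_on_cong[OF refl]) (auto simp: \<phi>_def)
  qed
  have "path \<phi>"
    unfolding path_def continuous_on_eq_continuous_within
  proof
    fix s :: real assume s: "s \<in> {0..1}"
    show "continuous (at s within {0..1}) \<phi>"
    proof (cases "s < 1")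
      case True
      define r where "r = (s + 1) / 2"
      have r: "s < r" "r < 1" using True by (auto simp: r_def)
      have "continuous (at s within {0..r}) \<phi>"
        using \<phi>_init[OF r(2)] s r by (auto simp: continuous_on_eq_continuous_within)
      moreover have "at s within {0..1} = at s within {0..r}"
        by (rule at_within_nhd[where S="{..<r}"]) (use r in auto)
      ultimately show ?thesis by simp
    next
      case False
      then have s1: "s = 1" using s by simp
      show ?thesis unfolding continuous_within_eps_delta
      proof (intro allI impI)
        fix e :: real assume "e > 0"
        then obtain N where N: "1 / real (Suc N) < e" using nat_approx_posE by blast
        \<comment> \<open>If 1 - t < 1 / (N + 2), then t / (1 - t) is at least N, so
          \<open>\<phi> t\<close> belongs to a piece with index at least \<open>N\<close>, inside
          the ball of radius 1 / (N + 1).\<close>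
        have "dist (\<phi> t) (\<phi> s) < e" if t: "t \<in> {0..1}" "dist t s < 1 / real (N + 2)" for t
        proof (cases "t < 1")
          case True
          have "1 - t < 1 / real (N + 2)" using t s1 by (simp add: dist_real_def)
          then have "(1 - t) * real (N + 2) < 1" by (simp add: field_simps)
          then have "real N * (1 - t) \<le> t" using t by (simp add: algebra_simps)
          then have "real N \<le> t / (1 - t)" using True by (simp add: field_simps)
          then have "N \<le> nat \<lfloor>t / (1 - t)\<rfloor>" by (simp add: le_nat_floor)
          then have "1 / real (Suc (nat \<lfloor>t / (1 - t)\<rfloor>)) \<le> 1 / real (Suc N)" by (intro frac_le) auto
          moreover have "\<phi> t \<in> ball x (1 / real (Suc (nat \<lfloor>t / (1 - t)\<rfloor>)))"
            using q_in[of "t / (1 - t)"] True t by (simp add: \<phi>_def)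
          ultimately show ?thesis using N s1 by (simp add: \<phi>_def dist_commute)
        qed (use \<open>e > 0\<close> s1 in \<open>simp add: \<phi>_def\<close>)
        then show "\<exists>d>0. \<forall>x'\<in>{0..1}. dist x' s < d \<longrightarrow> dist (\<phi> x') (\<phi> s) < e"
          by (intro exI[of _ "1 / real (N + 2)"]) auto
      qed
    qed
  qed
  have u: "{0..1::real} = insert 1 {0..<1}" by auto
  have im\<phi>: "path_image \<phi> \<subseteq> insert x U"
    unfolding path_image_def u using \<phi>_in by (auto simp: \<phi>_def)
  \<comment> \<open>The concatenation may cross itself; distinct ends allow an injective arc to be
    extracted from it.\<close>
  have "\<phi> 0 \<noteq> x" using \<phi>_in[of 0] xU by auto
  then obtain r where r: "arc r" "path_image r \<subseteq> path_image \<phi>" "pathstart r = \<phi> 0" "pathfinish r = x"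
    using path_contains_arc[of \<phi> "\<phi> 0" x] \<open>path \<phi>\<close> by (auto simp: pathstart_def pathfinish_def \<phi>_def)
  have r1: "r 1 = x" using r(4) by (simp add: pathfinish_def)
  have "r ` {0..<1} \<subseteq> U"
  proof (rule image_subsetI)
    fix t :: real assume t: "t \<in> {0..<1}"
    then have "r t \<in> path_image r" unfolding path_image_def by (intro imageI) auto
    then have "r t \<in> insert x U" using r(2) im\<phi> by blast
    moreover have "r t \<noteq> r 1"
    proof
      assume "r t = r 1"
      then have "t = 1" using r(1) t unfolding arc_def by (elim conjE) (erule inj_onD; simp)
      then show False using t by simp
    qed
    ultimately show "r t \<in> U" using r1 by auto
  qed
  moreover have "path_image r \<subseteq> closure U" using r(2) im\<phi> xU(2) closure_subset by blast
  ultimately show ?thesis unfolding accessible_from_def using U x r(1) r1 by blast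
qed

text \<open>The set is star-shaped about the antipode \<open>- \<zeta>\<close>, which survives
  because \<open>r\<close> is at most 2.\<close>

lemma connected_disc_minus_boundary_ball:
  fixes \<zeta> :: "'a::euclidean_space"
  assumes z: "norm \<zeta> = 1" and r: "0 < r" "r \<le> 2"
  shows "connected (cball 0 1 - ball \<zeta> r)"
proof (rule starlike_imp_connected)
  show "starlike (cball 0 1 - ball \<zeta> r)" unfolding starlike_def
  proof (intro bexI ballI)
    have "dist \<zeta> (- \<zeta>) = 2" using z by (simp add: dist_norm flip: scaleR_2)
    then show "- \<zeta> \<in> cball 0 1 - ball \<zeta> r" using z r by simp
    fix v assume v: "v \<in> cball 0 1 - ball \<zeta> r"
    show "closed_segment (- \<zeta>) v \<subseteq> cball 0 1 - ball \<zeta> r"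
    proof
      fix w assume w: "w \<in> closed_segment (- \<zeta>) v"
      then obtain u where u: "0 \<le> u" "u \<le> 1" "w = (1 - u) *\<^sub>R (- \<zeta>) + u *\<^sub>R v" by (auto simp: closed_segment_def)
      have "closed_segment (- \<zeta>) v \<subseteq> cball 0 1" using v z by (intro closed_segment_subset) auto
      then have "w \<in> cball 0 1" using w by blast
      define s where "s = (norm (v - \<zeta>))\<^sup>2"
      have "r \<le> norm (v - \<zeta>)" using v by (simp add: dist_norm norm_minus_commute)
      then have sr: "r\<^sup>2 \<le> s" unfolding s_def using r by (intro power_mono) auto
      have zz: "inner \<zeta> \<zeta> = 1" using z by (simp add: dot_square_norm)
      define a where "a = v - \<zeta>"
      have sa: "s = inner a a" unfolding s_def a_def power2_norm_eq_inner ..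
      have za: "inner \<zeta> v - 1 = inner \<zeta> a" unfolding a_def using zz by (simp add: inner_diff_right)
      have s_eq: "s = inner v v - 2 * inner \<zeta> v + 1"
        unfolding sa a_def using zz by (simp add: inner_diff algebra_simps inner_commute)
      have "(norm v)\<^sup>2 \<le> 1" using v by (simp add: power_le_one)
      then have vv: "inner v v \<le> 1" by (simp add: power2_norm_eq_inner)
      have wa: "w - \<zeta> = u *\<^sub>R a - (2 * (1 - u)) *\<^sub>R \<zeta>"
        unfolding u(3) a_def by (simp add: algebra_simps flip: scaleR_2)
      have "(norm (w - \<zeta>))\<^sup>2 = u\<^sup>2 * s + (1 - u)\<^sup>2 * 4 + u * (1 - u) * (- 4 * (inner \<zeta> v - 1))"
        unfolding wa za sa power2_norm_eq_inner
        by (simp add: inner_diff_left inner_diff_right zz inner_commute[of a \<zeta>] power2_eq_square algebra_simps)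
      \<comment> \<open>Since |v| is at most 1, the cross term dominates twice \<open>s\<close>. All
        three coefficients are then at least those of (u + (1 - u))^2 r^2 = r^2.\<close>
      moreover have "u * (1 - u) * (2 * s) \<le> u * (1 - u) * (- 4 * (inner \<zeta> v - 1))"
        using u s_eq vv by (intro mult_left_mono) auto
      moreover have "u * (1 - u) * (2 * r\<^sup>2) \<le> u * (1 - u) * (2 * s)" using u sr by (intro mult_left_mono) auto
      moreover have "u\<^sup>2 * r\<^sup>2 \<le> u\<^sup>2 * s" using sr by (intro mult_left_mono) auto
      moreover have "(1 - u)\<^sup>2 * r\<^sup>2 \<le> (1 - u)\<^sup>2 * 4"
        using r power_mono[of r 2 2] by (intro mult_left_mono) auto
      ultimately have sum_le: "u\<^sup>2 * r\<^sup>2 + (1 - u)\<^sup>2 * r\<^sup>2 + u * (1 - u) * (2 * r\<^sup>2) \<le> (norm (w - \<zeta>))\<^sup>2" by linarith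
      have sum_eq: "u\<^sup>2 * r\<^sup>2 + (1 - u)\<^sup>2 * r\<^sup>2 + u * (1 - u) * (2 * r\<^sup>2) = r\<^sup>2"
        by (simp add: power2_eq_square algebra_simps)
      have "r\<^sup>2 \<le> (norm (w - \<zeta>))\<^sup>2" using sum_le unfolding sum_eq .
      then have "r \<le> norm (w - \<zeta>)" by (rule power2_le_imp_le) (rule norm_ge_zero)
      then show "w \<in> cball 0 1 - ball \<zeta> r" using \<open>w \<in> cball 0 1\<close> by (simp add: dist_norm norm_minus_commute)
    qed
  qed
qed

text \<open>Janiszewski is applied to \<open>D\<close> and to \<open>K\<close> joined with the
  sphere of radius \<open>\<epsilon>\<close>, where \<open>K\<close> is the part of \<open>D\<close>
  coming from outside a small ball at \<open>\<zeta>\<close>. They meet exactly in the connected set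
  \<open>K\<close>. Neither separates two points near \<open>f \<zeta>\<close>, so their union does
  not either, and the connecting set cannot cross the sphere.\<close>

lemma complement_of_disc_locally_connected:
  fixes D :: "complex set"
  assumes hom: "homeomorphism (cball 0 1) D f g" and z: "cmod \<zeta> = 1" and e: "\<epsilon> > 0"
  shows "\<exists>\<delta>>0. \<forall>p\<in>- D \<inter> ball (f \<zeta>) \<delta>. \<forall>q\<in>- D \<inter> ball (f \<zeta>) \<delta>. path_component (- D \<inter> ball (f \<zeta>) \<epsilon>) p q"
proof -
  let ?x = "f \<zeta>"
  have cont: "continuous_on (cball 0 1) f" and im: "f ` cball 0 1 = D" and inj: "inj_on f (cball 0 1)"
    using hom by (auto simp: homeomorphism_def intro: inj_on_inverseI)
  have compD: "compact D" using cont im compact_continuous_image compact_cball by metis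
  have cD: "connected (- D)"
  proof (rule connected_complement_homeomorphic_convex_compact)
    show "D homeomorphic (cball 0 1 :: complex set)" using hom homeomorphic_def homeomorphic_sym by blast
  qed auto
  obtain r0 where r0: "r0 > 0" "\<And>z. z \<in> cball 0 1 \<Longrightarrow> dist z \<zeta> < r0 \<Longrightarrow> dist (f z) ?x < \<epsilon>"
    using cont z e unfolding continuous_on_iff by (metis dist_0_norm mem_cball order_refl)
  define r where "r = min r0 1"
  have r: "0 < r" "r \<le> 2" using r0(1) by (auto simp: r_def)
  define K where "K = f ` (cball 0 1 - ball \<zeta> r)"
  have DK: "y \<in> ball ?x \<epsilon>" if "y \<in> D" "y \<notin> K" for y
  proof -
    obtain v where v: "v \<in> cball 0 1" "y = f v" using \<open>y \<in> D\<close> im by blast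
    then have "v \<in> ball \<zeta> r" using that(2) by (auto simp: K_def)
    then show ?thesis using r0(2)[OF v(1)] v(2) by (simp add: r_def dist_commute)
  qed
  have compK: "compact K" unfolding K_def
    using cont by (intro compact_continuous_image compact_diff) (auto intro: continuous_on_subset)
  have connK: "connected K" unfolding K_def
    using connected_disc_minus_boundary_ball[OF z r] cont by (intro connected_continuous_image) (auto intro: continuous_on_subset)
  have KD: "K \<subseteq> D" using im by (auto simp: K_def)
  have "?x \<notin> K"
  proof
    assume "?x \<in> K"
    then obtain v where "v \<in> cball 0 1" "v \<notin> ball \<zeta> r" "f v = f \<zeta>" by (auto simp: K_def)
    then show False using inj_onD[OF inj, of v \<zeta>] z r by simp
  qed
  then have "?x \<in> - K" "open (- K)" using compK by (simp_all add: compact_imp_closed open_Compl)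
  then obtain d where d: "d > 0" "ball ?x d \<subseteq> - K" using openE by blast
  \<comment> \<open>Below \<open>d\<close> the ball misses \<open>K\<close>, below
    \<open>\<epsilon>\<close> it misses the sphere; a segment inside it then shows that
    \<open>T\<close> does not separate \<open>p\<close> from \<open>q\<close>.\<close>
  define \<delta> where "\<delta> = min d \<epsilon>"
  have "path_component (- D \<inter> ball ?x \<epsilon>) p q" if p: "p \<in> - D \<inter> ball ?x \<delta>" and q: "q \<in> - D \<inter> ball ?x \<delta>" for p q
  proof -
    define T where "T = K \<union> sphere ?x \<epsilon>"
    have "connected_component (- (D \<union> T)) p q"
    proof (rule Janiszewski)
      show "closed T" unfolding T_def using compK by (simp add: compact_imp_closed closed_Un)
      have "D \<inter> sphere ?x \<epsilon> \<subseteq> K"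
      proof
        fix y assume y: "y \<in> D \<inter> sphere ?x \<epsilon>"
        show "y \<in> K"
        proof (rule ccontr)
          assume "y \<notin> K"
          with DK[of y] y show False by simp
        qed
      qed
      then have "D \<inter> T = K" using KD by (auto simp: T_def)
      then show "connected (D \<inter> T)" using connK by simp
      show "connected_component (- D) p q" using cD p q by (auto simp: connected_iff_connected_component)
      have "closed_segment p q \<subseteq> ball ?x \<delta>" using p q by (intro closed_segment_subset) auto
      moreover have "ball ?x \<delta> \<subseteq> - T" using d by (auto simp: T_def \<delta>_def)
      ultimately show "connected_component (- T) p q"
        unfolding connected_component_def by (intro exI[of _ "closed_segment p q"]) auto
    qed (rule compD)
    then obtain C where C: "connected C" "C \<subseteq> - (D \<union> T)" "p \<in> C" "q \<in> C" unfolding connected_component_def by blast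
    \<comment> \<open>\<open>C\<close> is connected, starts in the ball at \<open>p\<close>, and
      avoids the sphere because the sphere is part of \<open>T\<close>.\<close>
    have "C \<subseteq> ball ?x \<epsilon>"
    proof (rule ccontr)
      assume "\<not> ?thesis"
      moreover have "p \<in> ball ?x \<epsilon>" using p by (simp add: \<delta>_def)
      ultimately have "C \<inter> frontier (ball ?x \<epsilon>) \<noteq> {}" using C by (intro connected_Int_frontier) auto
      then show False using C(2) e by (auto simp: T_def)
    qed
    then have "connected_component (- D \<inter> ball ?x \<epsilon>) p q"
      using C unfolding connected_component_def by (intro exI[of _ C]) auto
    moreover have "open (- D \<inter> ball ?x \<epsilon>)" using compD by (simp add: compact_imp_closed open_Compl open_Int)
    ultimately show ?thesis by (simp add: open_path_connected_component)
  qed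
  moreover have "\<delta> > 0" using d e by (simp add: \<delta>_def)
  ultimately show ?thesis by blast
qed

text \<open>Invariance of domain in both directions identifies \<open>interior D\<close> with the
  image of the open disc. Inner accessibility then comes from images of radii, outer accessibility
  from local connectedness of the complement.\<close>

lemma homeomorphic_disc_imp_biaccessible:
  fixes D :: "complex set"
  assumes "D homeomorphic (cball 0 1 :: complex set)"
  shows "biaccessible D"
proof -
  obtain f g where hom: "homeomorphism (cball (0::complex) 1) D f g"
    using assms unfolding homeomorphic_def by (metis homeomorphism_symD)
  have cont: "continuous_on (cball 0 1) f" and im: "f ` cball 0 1 = D" and inj: "inj_on f (cball 0 1)"
    using hom by (auto simp: homeomorphism_def intro: inj_on_inverseI)
  have compD: "compact D" using cont im compact_continuous_image compact_cball by metis
  have intD: "interior D = f ` ball 0 1"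
  proof
    have "open (f ` ball 0 1)"
      using cont inj by (intro invariance_of_domain) (auto intro: continuous_on_subset inj_on_subset)
    then show "f ` ball 0 1 \<subseteq> interior D" using im by (intro interior_maximal) auto
    have gint: "continuous_on (interior D) g" "inj_on g (interior D)"
      using hom interior_subset[of D] by (auto simp: homeomorphism_def intro: continuous_on_subset intro!: inj_on_inverseI[of _ f])
    then have "open (g ` interior D)" by (intro invariance_of_domain) auto
    moreover have "g ` interior D \<subseteq> cball 0 1" using hom interior_subset[of D] by (auto simp: homeomorphism_def)
    ultimately have "g ` interior D \<subseteq> ball 0 1" using interior_maximal interior_cball by metis
    show "interior D \<subseteq> f ` ball 0 1"
    proof
      fix y assume y: "y \<in> interior D"
      then have "f (g y) = y" using hom interior_subset by (metis homeomorphism_apply2 subsetD)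
      moreover have "g y \<in> ball 0 1" using y \<open>g ` interior D \<subseteq> ball 0 1\<close> by blast
      ultimately show "y \<in> f ` ball 0 1" by (metis image_eqI)
    qed
  qed
  have frD: "\<exists>\<zeta>. cmod \<zeta> = 1 \<and> f \<zeta> = x" if "x \<in> frontier D" for x
  proof -
    have "x \<in> D" "x \<notin> interior D" using that compD by (auto simp: frontier_def compact_imp_closed)
    then obtain \<zeta> where "\<zeta> \<in> cball 0 1" "x = f \<zeta>" "\<zeta> \<notin> ball 0 1" using im intD by blast
    then show ?thesis by auto
  qed
  show ?thesis
  proof
    show "compact D" by fact
    show "connected (- D)" using assms by (intro connected_complement_homeomorphic_convex_compact) auto
    show "connected (interior D)" unfolding intD
      using cont by (intro connected_continuous_image) (auto intro: continuous_on_subset)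
    fix x assume x: "x \<in> frontier D"
    then obtain \<zeta> where z: "cmod \<zeta> = 1" "f \<zeta> = x" using frD by blast
    show "accessible_from x (- D)"
      unfolding z(2)[symmetric]
    proof (rule accessible_from_locally_connected)
      show "open (- D)" using compD by (simp add: compact_imp_closed open_Compl)
      show "f \<zeta> \<in> frontier (- D)" using x z by simp
    qed (rule complement_of_disc_locally_connected[OF hom z(1)])
    \<comment> \<open>The image of the radius ending at \<open>\<zeta>\<close>; all its points
      before the last one come from the open disc.\<close>
    define \<phi> where "\<phi> t = f (of_real t * \<zeta>)" for t :: real
    have tz: "of_real t * \<zeta> \<in> cball 0 1" if "t \<in> {0..1}" for t using that z by (simp add: norm_mult)
    have arc\<phi>: "arc \<phi>" unfolding arc_def path_def
    proof
      show "continuous_on {0..1} \<phi>" unfolding \<phi>_def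
        by (rule continuous_on_compose2[OF cont]) (use tz in \<open>auto intro!: continuous_intros\<close>)
      show "inj_on \<phi> {0..1}"
      proof (rule inj_onI)
        fix s t :: real assume "s \<in> {0..1}" "t \<in> {0..1}" "\<phi> s = \<phi> t"
        then have "of_real s * \<zeta> = of_real t * \<zeta>" unfolding \<phi>_def using inj_onD[OF inj] tz by blast
        then show "s = t" using z by auto
      qed
    qed
    have \<phi>1: "\<phi> 1 = x" by (simp add: \<phi>_def z)
    have \<phi>in: "\<phi> ` {0..<1} \<subseteq> interior D" unfolding intD \<phi>_def using z by (auto simp: norm_mult)
    have "path_image \<phi> \<subseteq> closure (interior D)"
    proof -
      have "\<phi> ` closure {0..<1} \<subseteq> closure (interior D)"
        using arc\<phi> \<phi>in closure_subset by (intro image_closure_subset) (auto simp: arc_def path_def)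
      then show ?thesis by (simp add: path_image_def)
    qed
    moreover from this have "x \<in> frontier (interior D)"
      using x \<phi>1 by (auto simp: frontier_def path_image_def)
    ultimately show "accessible_from x (interior D)"
      unfolding accessible_from_def using arc\<phi> \<phi>1 \<phi>in by blast
  qed
qed

lemma biaccessible_complex_iff:
  fixes D :: "complex set"
  assumes "compact D" and "interior D \<noteq> {}"
  shows "D homeomorphic (cball 0 1 :: complex set) \<longleftrightarrow>
    connected (interior D) \<and> connected (- D) \<and>
    (\<forall>x \<in> frontier D. accessible_from x (interior D)) \<and>
    (\<forall>x \<in> frontier D. accessible_from x (- D))"
proof
  assume "D homeomorphic (cball 0 1 :: complex set)"
  then interpret biaccessible D by (rule homeomorphic_disc_imp_biaccessible)
  show "connected (interior D) \<and> connected (- D) \<and>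
    (\<forall>x \<in> frontier D. accessible_from x (interior D)) \<and>
    (\<forall>x \<in> frontier D. accessible_from x (- D))"
    using connected_interior connected_outside accessible_inside accessible_outside by blast
next
  assume "connected (interior D) \<and> connected (- D) \<and>
    (\<forall>x \<in> frontier D. accessible_from x (interior D)) \<and>
    (\<forall>x \<in> frontier D. accessible_from x (- D))"
  then interpret biaccessible D using assms(1) by unfold_locales auto
  show "D homeomorphic (cball 0 1 :: complex set)" using assms(2) by (rule homeomorphic_disc)
qed

subsection \<open>Transfer to the plane\<close>

context
  fixes h :: "'a::euclidean_space \<Rightarrow> 'b::euclidean_space"
  assumes lin: "linear h" and bij: "bij h"
begin

lemma linear_bij_image_interior: "interior (h ` S) = h ` interior S"
proof
  obtain k where k: "linear k" "\<And>v. k (h v) = v"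
    using linear_injective_left_inverse[OF lin bij_is_inj[OF bij]] by (metis comp_apply id_apply)
  have hk: "h (k v) = v" for v using k(2) bij by (metis bij_pointE)
  have op: "open (h ` A)" if "open A" for A
  proof -
    have "h ` A = k -` A" by (intro set_eqI) (metis hk k(2) image_iff vimage_eq)
    then show ?thesis using open_vimage[OF that linear_continuous_on] k(1) by (metis linear_conv_bounded_linear)
  qed
  show "h ` interior S \<subseteq> interior (h ` S)"
    by (intro interior_maximal image_mono op interior_subset) simp
  have "open (h -` interior (h ` S))"
    using lin by (intro open_vimage linear_continuous_on) (auto simp: linear_conv_bounded_linear)
  moreover have "h -` interior (h ` S) \<subseteq> S"
    using interior_subset[of "h ` S"] bij by (metis bij_is_inj inj_vimage_image_eq vimage_mono)
  ultimately have "h -` interior (h ` S) \<subseteq> interior S" by (intro interior_maximal)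
  then have "h ` (h -` interior (h ` S)) \<subseteq> h ` interior S" by (rule image_mono)
  then show "interior (h ` S) \<subseteq> h ` interior S" by (simp add: surj_image_vimage_eq bij_is_surj[OF bij])
qed

lemma linear_bij_image_closure: "closure (h ` S) = h ` closure S"
  using closure_injective_linear_image[OF lin bij_is_inj[OF bij]] by simp

lemma linear_bij_image_frontier: "frontier (h ` S) = h ` frontier S"
  unfolding frontier_def linear_bij_image_interior linear_bij_image_closure
  using bij_is_inj[OF bij] by (simp add: image_set_diff)

lemma linear_bij_image_accessible_from:
  assumes "accessible_from x U"
  shows "accessible_from (h x) (h ` U)"
proof -
  obtain \<phi> where \<phi>: "open U" "x \<in> frontier U" "arc \<phi>" "path_image \<phi> \<subseteq> closure U" "\<phi> 1 = x" "\<phi> ` {0..<1} \<subseteq> U"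
    using assms unfolding accessible_from_def by blast
  have "open (h ` U)" using linear_bij_image_interior[of U] \<phi>(1) by (metis interior_open open_interior)
  moreover have "arc (h \<circ> \<phi>)" using \<phi>(3) arc_linear_image_eq[OF lin bij_is_inj[OF bij]] by blast
  moreover have "path_image (h \<circ> \<phi>) \<subseteq> closure (h ` U)"
    unfolding linear_bij_image_closure path_image_compose using \<phi>(4) by (rule image_mono)
  moreover have "(h \<circ> \<phi>) ` {0..<1} \<subseteq> h ` U" unfolding image_comp[symmetric] using \<phi>(6) by (rule image_mono)
  moreover have "h x \<in> frontier (h ` U)" using \<phi>(2) linear_bij_image_frontier by blast
  ultimately show ?thesis unfolding accessible_from_def using \<phi>(5) by (metis comp_apply)
qed

end

text \<open>The converse is the forward statement for the linear inverse \<open>k\<close>.\<close>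

lemma linear_bij_image_accessible_from_iff:
  fixes h :: "'a::euclidean_space \<Rightarrow> 'b::euclidean_space"
  assumes "linear h" "bij h"
  shows "accessible_from (h x) (h ` U) \<longleftrightarrow> accessible_from x U"
proof
  obtain k where k: "linear k" "\<And>v. k (h v) = v"
    using linear_injective_left_inverse[OF assms(1) bij_is_inj[OF assms(2)]] by (metis comp_apply id_apply)
  then have hk: "h (k v) = v" for v using assms(2) by (metis bij_pointE)
  have "bij k" by (rule bijI') (metis hk, metis k(2))
  assume "accessible_from (h x) (h ` U)"
  from linear_bij_image_accessible_from[OF k(1) \<open>bij k\<close> this] show "accessible_from x U"
    by (simp add: image_image k(2))
qed (rule linear_bij_image_accessible_from[OF assms])

theorem theorem1:
  fixes D :: "(real ^ 2) set"
  assumes "compact D" and "interior D \<noteq> {}"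
  shows "D homeomorphic (cball 0 1 :: (real ^ 2) set) \<longleftrightarrow>
    connected (interior D) \<and>
    connected (- D) \<and>
    (\<forall>x \<in> frontier D. accessible_from x (interior D)) \<and>
    (\<forall>x \<in> frontier D. accessible_from x (- D))"
proof -
  define h where "h v = Complex (v $ 1) (v $ 2)" for v :: "real ^ 2"
  have lin: "linear h" unfolding h_def by (rule linearI) (auto simp: complex_eq_iff)
  have bij: "bij h"
  proof (rule bijI')
    show "h v = h w \<longleftrightarrow> v = w" for v w by (simp add: h_def vec_eq_iff forall_2)
    show "\<exists>v. z = h v" for z by (intro exI[of _ "vector [Re z, Im z]"]) (simp add: h_def)
  qed
  note inj = bij_is_inj[OF bij]
  have conn: "connected (h ` S) \<longleftrightarrow> connected S" for S
    using linear_homeomorphic_image[OF lin inj] homeomorphic_connectedness by metis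
  have comp: "compact (h ` D)" using assms(1) lin
    by (intro compact_continuous_image linear_continuous_on) (auto simp: linear_conv_bounded_linear)
  have Compl: "- h ` D = h ` (- D)" using bij by (simp add: bij_image_Compl_eq)
  \<comment> \<open>Compact convex sets of equal affine dimension are homeomorphic, so the model
    disc can be exchanged along with \<open>D\<close>.\<close>
  have disc: "(cball 0 1 :: (real ^ 2) set) homeomorphic (cball 0 1 :: complex set)"
    by (rule homeomorphic_convex_compact_sets) (simp_all add: aff_dim_cball)
  have "D homeomorphic (cball 0 1 :: (real ^ 2) set) \<longleftrightarrow> h ` D homeomorphic (cball 0 1 :: complex set)"
    using linear_homeomorphic_image[OF lin inj, of D] disc by (meson homeomorphic_sym homeomorphic_trans)
  then show ?thesis
    using biaccessible_complex_iff[OF comp] assms(2)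
    by (simp add: Compl linear_bij_image_interior[OF lin bij] linear_bij_image_frontier[OF lin bij] conn
        linear_bij_image_accessible_from_iff[OF lin bij])
qed

end
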